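(* Let $\mu,\tau$ be two distributions over $\Omega=\{1,\ldots,N\}$ and $\varepsilon>0$. There exists an algorithm, with conditional sampling access to $\mu$ and to $\tau$, which with probability at least $2/3$ outputs a value in $[d_{\mathrm{TV}}(\mu,\tau)-\varepsilon,\,d_{\mathrm{TV}}(\mu,\tau)+\varepsilon]$, using $O\big((\log\log N/\varepsilon^2+1/\varepsilon^7)\cdot\mathrm{poly}(\log\varepsilon^{-1})\big)$ conditional samples.
   Context: Conditional sampling access to a distribution $\mu$ over $\Omega$: an oracle which, given a set $A\subseteq\Omega$, returns an element of $A$ distributed according to $\mu$ conditioned on belonging to $A$, independently of past calls. $d_{\mathrm{TV}}(\mu,\tau)=\frac12\sum_{x\in\Omega}|\mu(x)-\tau(x)|$. *)

theory Defs
  imports "HOL-Probability.Probability" "HOL-Computational_Algebra.Polynomial"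
begin

definition d_TV :: "'a set \<Rightarrow> 'a pmf \<Rightarrow> 'a pmf \<Rightarrow> real" where
  "d_TV \<Omega> \<mu> \<tau> = 1 / 2 * (\<Sum>x\<in>\<Omega>. \<bar>pmf \<mu> x - pmf \<tau> x\<bar>)"

text \<open>
  \<open>orc A\<close> is the distribution of the answer to the query \<open>A\<close>. Conditioning on a \<open>\<mu>\<close>-null set is
  undefined; there the answer is still an element of \<open>A\<close>, but its distribution is unspecified.
  Nothing at all is promised about queries that are empty or not contained in \<open>\<Omega>\<close>.
\<close>

definition cond_sampling_oracle :: "'a set \<Rightarrow> 'a pmf \<Rightarrow> ('a set \<Rightarrow> 'a pmf) \<Rightarrow> bool" where
  "cond_sampling_oracle \<Omega> \<mu> orc \<longleftrightarrow>
     (\<forall>A. A \<subseteq> \<Omega> \<and> A \<noteq> {} \<longrightarrow>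
        set_pmf (orc A) \<subseteq> A \<and>
        (measure_pmf.prob \<mu> A > 0 \<longrightarrow> orc A = cond_pmf \<mu> A))"

text \<open>
  Adaptive randomized algorithms with conditional sampling access to two distributions, as
  decision trees: the algorithm either halts with a real output, queries one of the two oracles
  with a set and continues depending on the answer, or draws internal randomness. The tree
  does not depend on the two distributions.
\<close>

datatype 'a cond_alg =
    Output real
  | Sample_fst "'a set" "'a \<Rightarrow> 'a cond_alg"
  | Sample_snd "'a set" "'a \<Rightarrow> 'a cond_alg"
  | Random "nat pmf" "nat \<Rightarrow> 'a cond_alg"

text \<open>
  The joint distribution of the output and of the number of conditional samples drawn. Every query
  uses a fresh draw from the oracle, hence the answer is independent of past calls.
\<close>

primrec run :: "('a set \<Rightarrow> 'a pmf) \<Rightarrow> ('a set \<Rightarrow> 'a pmf) \<Rightarrow> 'a cond_alg \<Rightarrow> (real \<times> nat) pmf" where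
  "run M T (Output r) = return_pmf (r, 0)"
| "run M T (Sample_fst A k) = bind_pmf (M A) (\<lambda>x. map_pmf (apsnd Suc) (run M T (k x)))"
| "run M T (Sample_snd A k) = bind_pmf (T A) (\<lambda>x. map_pmf (apsnd Suc) (run M T (k x)))"
| "run M T (Random p k) = bind_pmf p (\<lambda>i. run M T (k i))"

text \<open>
  The bound inside the \<open>O\<close>, apart from the factor polynomial in \<open>log (1 / \<epsilon>)\<close>.
  With base 2 the iterated logarithm is nonnegative for every \<open>N \<ge> 2\<close>; for \<open>N = 1\<close>
  it is \<open>log 2 0 = 0\<close>.
\<close>

definition main_bound :: "nat \<Rightarrow> real \<Rightarrow> real" where
  "main_bound N \<epsilon> = log 2 (log 2 (real N)) / \<epsilon> ^ 2 + 1 / \<epsilon> ^ 7"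

end

theory Submission
  imports Defs
begin

text \<open>
  The distance is the expectation of \<open>max 0 (1 - \<tau> x / \<mu> x)\<close> for \<open>x\<close> drawn from \<open>\<mu>\<close>, so it can be
  averaged over \<open>O(1 / \<epsilon>\<^sup>2)\<close> samples once \<open>\<mu> x\<close> and \<open>\<tau> x\<close> are known up to a factor \<open>1 + O(\<epsilon>)\<close>.
  For a distribution \<open>\<nu>\<close>, let \<open>G\<close> be the probability that \<open>x\<close> is the answer to the query
  \<open>{x, y}\<close> for an independent sample \<open>y\<close>. Then \<open>G = \<nu> x * F\<close> with
  \<open>F = 1 + (\<Sum>y \<noteq> x. \<nu> y / (\<nu> x + \<nu> y))\<close>, a number between 1 and \<open>N\<close>. To estimate \<open>F\<close>, query
  \<open>S \<union> {x}\<close> for a random set \<open>S\<close> of density \<open>\<alpha>\<close>: the probability that \<open>x \<in> S\<close> or that the answer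
  is not \<open>x\<close> lies between \<open>\<alpha> F / (1 + \<alpha> F)\<close> and \<open>\<alpha> F\<close>. A binary search over the exponents of
  \<open>\<alpha> = 2 ^ -i\<close> finds a density with \<open>\<alpha> F\<close> of moderate size in \<open>O(log log N)\<close> queries, and at a slightly
  smaller density the probability is \<open>\<alpha> F\<close> up to a factor \<open>1 + O(\<epsilon>)\<close> and is estimated by repetition.
  The elements with \<open>G \<le> g\<close> have total mass at most \<open>2 g\<close>, so those with tiny \<open>G\<close> may be ignored.
\<close>

section \<open>Finitely supported distributions\<close>

lemma expectation_bind_finite:
  fixes h :: "'b \<Rightarrow> real"
  assumes "finite (set_pmf p)" "\<And>x. x \<in> set_pmf p \<Longrightarrow> finite (set_pmf (f x))"
  shows "measure_pmf.expectation (bind_pmf p f) h =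
    measure_pmf.expectation p (\<lambda>x. measure_pmf.expectation (f x) h)"
proof -
  have "measure_pmf.expectation (bind_pmf p f) h =
      (\<Sum>a\<in>set_pmf p. pmf p a *\<^sub>R measure_pmf.expectation (f a) h)"
    using assms by (intro pmf_expectation_bind) auto
  also have "\<dots> = measure_pmf.expectation p (\<lambda>x. measure_pmf.expectation (f x) h)"
    using assms by (intro integral_measure_pmf[symmetric]) auto
  finally show ?thesis .
qed

lemma expectation_mono_finite:
  fixes f g :: "'a \<Rightarrow> real"
  assumes "finite (set_pmf p)" "\<And>x. x \<in> set_pmf p \<Longrightarrow> f x \<le> g x"
  shows "measure_pmf.expectation p f \<le> measure_pmf.expectation p g"
  using assms by (intro integral_mono_AE integrable_measure_pmf_finite) (auto simp: AE_measure_pmf_iff)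

lemma expectation_cong_pmf:
  fixes f g :: "'a \<Rightarrow> real"
  assumes "\<And>x. x \<in> set_pmf p \<Longrightarrow> f x = g x"
  shows "measure_pmf.expectation p f = measure_pmf.expectation p g"
  using assms by (intro integral_cong_AE) (auto simp: AE_measure_pmf_iff)

lemma prob_bind_pmf:
  "measure_pmf.prob (bind_pmf p f) A = measure_pmf.expectation p (\<lambda>x. measure_pmf.prob (f x) A)"
proof -
  have "emeasure (bind_pmf p f) A = (\<integral>\<^sup>+x. ennreal (measure_pmf.prob (f x) A) \<partial>p)"
    by (simp flip: measure_pmf.emeasure_eq_measure)
  also have "\<dots> = ennreal (measure_pmf.expectation p (\<lambda>x. measure_pmf.prob (f x) A))"
    by (intro nn_integral_eq_integral measure_pmf.integrable_const_bound[where B = 1]) auto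
  finally show ?thesis
    by (simp add: measure_pmf.emeasure_eq_measure integral_nonneg_AE)
qed

text \<open>Either the first stage leaves the good set \<open>Q\<close>, or the second stage fails
  from a good value, so the integrand is at most the indicator of \<open>\<not> Q x\<close> plus
  \<open>b\<close>. Chained through \<open>bind_alg\<close>, this adds up the failure probabilities
  of successive stages.\<close>

lemma prob_bind_union_bound:
  assumes "measure_pmf.prob p {x. \<not> Q x} \<le> a" "0 \<le> b"
    and "\<And>x. x \<in> set_pmf p \<Longrightarrow> Q x \<Longrightarrow> measure_pmf.prob (f x) B \<le> b"
  shows "measure_pmf.prob (bind_pmf p f) B \<le> a + b"
proof -
  have int: "integrable p (indicator A :: _ \<Rightarrow> real)" for A
    by (intro measure_pmf.integrable_const_bound[where B = 1]) auto
  have "measure_pmf.prob (bind_pmf p f) B \<le>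
      measure_pmf.expectation p (\<lambda>x. indicator {x. \<not> Q x} x + b)"
    unfolding prob_bind_pmf
  proof (intro integral_mono_AE)
    show "integrable p (\<lambda>x. measure_pmf.prob (f x) B)"
      by (intro measure_pmf.integrable_const_bound[where B = 1]) auto
    show "integrable p (\<lambda>x. indicator {x. \<not> Q x} x + b)"
      using int by (intro Bochner_Integration.integrable_add) auto
    show "AE x in p. measure_pmf.prob (f x) B \<le> indicator {x. \<not> Q x} x + b"
      using assms(2,3) measure_pmf.prob_le_1[of "f _" B]
      by (auto simp: AE_measure_pmf_iff indicator_def intro: add_increasing2)
  qed
  also have "\<dots> = measure_pmf.prob p {x. \<not> Q x} + b"
    using int[of "{x. \<not> Q x}"] by (subst Bochner_Integration.integral_add) auto
  finally show ?thesis
    using assms(1) by simp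
qed

lemma zero_one_pmf_eq_bernoulli:
  fixes p :: "real pmf"
  assumes "set_pmf p \<subseteq> {0, 1}"
  shows "p = map_pmf of_bool (bernoulli_pmf (pmf p 1))"
proof (rule pmf_eqI)
  fix i :: real
  have s: "pmf p 0 + pmf p 1 = 1"
    using sum_pmf_eq_1[of "{0, 1}" p] assms by simp
  have 1: "pmf (map_pmf of_bool (bernoulli_pmf q)) (of_bool b :: real) = pmf (bernoulli_pmf q) b" for q b
    by (rule pmf_map_inj') (auto simp: inj_def)
  show "pmf p i = pmf (map_pmf of_bool (bernoulli_pmf (pmf p 1))) i"
  proof (cases "i \<in> {0, 1}")
    case True
    then show ?thesis
      using 1[of "pmf p 1" True] 1[of "pmf p 1" False] s by (auto simp: pmf_le_1)
  next
    case False
    then have "i \<notin> set_pmf p" "i \<notin> set_pmf (map_pmf of_bool (bernoulli_pmf (pmf p 1)))"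
      using assms by auto
    then show ?thesis
      unfolding pmf_eq_0_set_pmf[symmetric] by simp
  qed
qed

section \<open>Random subsets\<close>

definition random_subset :: "'a set \<Rightarrow> real \<Rightarrow> 'a set pmf" where
  "random_subset A \<alpha> = map_pmf (\<lambda>f. {y \<in> A. f y}) (Pi_pmf A False (\<lambda>_. bernoulli_pmf \<alpha>))"

lemma random_subset_insert:
  assumes "finite A" "y \<notin> A"
  shows "random_subset (insert y A) \<alpha> =
    bind_pmf (bernoulli_pmf \<alpha>) (\<lambda>b. map_pmf (\<lambda>S. if b then insert y S else S) (random_subset A \<alpha>))"
proof -
  have "{z. (z = y \<or> z \<in> A) \<and> (z = y \<longrightarrow> b) \<and> (z \<noteq> y \<longrightarrow> f z)} =
      (if b then insert y {z \<in> A. f z} else {z \<in> A. f z})" for b f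
    using assms by auto
  then show ?thesis
    unfolding random_subset_def
    by (subst Pi_pmf_insert'[OF assms])
      (auto simp: map_bind_pmf bind_return_pmf map_pmf_def[symmetric] map_pmf_comp
        intro!: bind_pmf_cong map_pmf_cong)
qed

lemma set_random_subset: "set_pmf (random_subset A \<alpha>) \<subseteq> Pow A"
  by (auto simp: random_subset_def)

lemma finite_set_random_subset: "finite A \<Longrightarrow> finite (set_pmf (random_subset A \<alpha>))"
  using finite_subset[OF set_random_subset] by auto

text \<open>Conditioning on the independent coin of \<open>y\<close>. The expectation bounds below
  rest on this recursion.\<close>

lemma expectation_random_subset_insert:
  fixes g :: "'a set \<Rightarrow> real"
  assumes "finite A" "y \<notin> A" "0 \<le> \<alpha>" "\<alpha> \<le> 1"
  shows "measure_pmf.expectation (random_subset (insert y A) \<alpha>) g =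
    \<alpha> * measure_pmf.expectation (random_subset A \<alpha>) (\<lambda>S. g (insert y S)) +
    (1 - \<alpha>) * measure_pmf.expectation (random_subset A \<alpha>) g"
  using assms finite_set_random_subset[OF assms(1), of \<alpha>]
  by (simp add: random_subset_insert expectation_bind_finite)

text \<open>
  Conditioning on \<open>y \<in> S\<close> or not and using \<open>1 + R + r y \<le> (1 + R) * (1 + r y)\<close> bounds the
  \<open>y\<close>-th term of the product by the expectation of \<open>r y / (1 + sum r S)\<close> over the event
  \<open>y \<in> S\<close>. Summed over \<open>y\<close>, these and the first term give the expectation of
  \<open>(1 + sum r S) / (1 + sum r S)\<close>.
\<close>

lemma expectation_inverse_weight_le:
  fixes r :: "'a \<Rightarrow> real"
  assumes A: "finite A" and \<alpha>: "0 \<le> \<alpha>" "\<alpha> \<le> 1" and r: "\<And>y. y \<in> A \<Longrightarrow> r y \<ge> 0"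
  shows "measure_pmf.expectation (random_subset A \<alpha>) (\<lambda>S. 1 / (1 + sum r S)) *
    (1 + \<alpha> * (\<Sum>y\<in>A. r y / (1 + r y))) \<le> 1"
proof -
  let ?E = "\<lambda>B. measure_pmf.expectation (random_subset B \<alpha>)"
  define M where "M = ?E A (\<lambda>S. 1 / (1 + sum r S))"
  have step: "M * (\<alpha> * (r y / (1 + r y))) \<le> ?E A (\<lambda>S. of_bool (y \<in> S) * r y / (1 + sum r S))"
    if y: "y \<in> A" for y
  proof -
    define B where "B = A - {y}"
    have B: "finite B" "y \<notin> B" "A = insert y B"
      using A y by (auto simp: B_def)
    have S: "sum r S \<ge> 0" "sum r (insert y S) = r y + sum r S" "y \<notin> S"
      if "S \<in> set_pmf (random_subset B \<alpha>)" for S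
    proof -
      have "S \<subseteq> B"
        using that set_random_subset by auto
      then show "sum r S \<ge> 0" "sum r (insert y S) = r y + sum r S" "y \<notin> S"
        using r B by (auto intro!: sum_nonneg sum.insert finite_subset[of S B])
    qed
    have ry: "r y \<ge> 0"
      using r y by auto
    have "M = \<alpha> * ?E B (\<lambda>S. 1 / (1 + sum r (insert y S))) + (1 - \<alpha>) * ?E B (\<lambda>S. 1 / (1 + sum r S))"
      using B \<alpha> by (simp add: M_def expectation_random_subset_insert)
    also have "\<dots> \<le> \<alpha> * ?E B (\<lambda>S. 1 / (1 + sum r S)) + (1 - \<alpha>) * ?E B (\<lambda>S. 1 / (1 + sum r S))"
      using B \<alpha> S ry finite_set_random_subset[OF B(1)]
      by (intro add_right_mono mult_left_mono expectation_mono_finite) (auto intro!: divide_left_mono mult_pos_pos add_pos_nonneg)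
    finally have M: "M \<le> ?E B (\<lambda>S. 1 / (1 + sum r S))"
      by (simp add: algebra_simps)
    have "M * (\<alpha> * (r y / (1 + r y))) \<le> ?E B (\<lambda>S. 1 / (1 + sum r S)) * (\<alpha> * (r y / (1 + r y)))"
      using M ry \<alpha> by (intro mult_right_mono) auto
    also have "\<dots> = \<alpha> * ?E B (\<lambda>S. r y / (1 + r y) * (1 / (1 + sum r S)))"
      unfolding integral_mult_right_zero by (simp add: ac_simps)
    also have "\<dots> \<le> \<alpha> * ?E B (\<lambda>S. r y / (1 + sum r (insert y S)))"
    proof (intro mult_left_mono expectation_mono_finite finite_set_random_subset B \<alpha>)
      fix S assume S': "S \<in> set_pmf (random_subset B \<alpha>)"
      have "1 + sum r (insert y S) \<le> (1 + r y) * (1 + sum r S)"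
        using S[OF S'] ry by (simp add: algebra_simps)
      then have "r y / ((1 + r y) * (1 + sum r S)) \<le> r y / (1 + sum r (insert y S))"
        using S[OF S'] ry by (intro divide_left_mono mult_pos_pos) auto
      then show "r y / (1 + r y) * (1 / (1 + sum r S)) \<le> r y / (1 + sum r (insert y S))"
        by simp
    qed
    also have "\<dots> = ?E A (\<lambda>S. of_bool (y \<in> S) * r y / (1 + sum r S))"
    proof -
      have "?E B (\<lambda>S. of_bool (y \<in> S) * r y / (1 + sum r S)) = ?E B (\<lambda>S. 0)"
        using S by (intro expectation_cong_pmf) auto
      then show ?thesis
        using B \<alpha> by (simp add: expectation_random_subset_insert)
    qed
    finally show ?thesis .
  qed
  have fin: "finite (set_pmf (random_subset A \<alpha>))"
    using A by (rule finite_set_random_subset)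
  note int = integrable_measure_pmf_finite[OF fin]
  have "M * (1 + \<alpha> * (\<Sum>y\<in>A. r y / (1 + r y))) = M + (\<Sum>y\<in>A. M * (\<alpha> * (r y / (1 + r y))))"
    by (simp add: algebra_simps sum_distrib_left)
  also have "\<dots> \<le> M + (\<Sum>y\<in>A. ?E A (\<lambda>S. of_bool (y \<in> S) * r y / (1 + sum r S)))"
    using step by (intro add_left_mono sum_mono)
  also have "\<dots> = ?E A (\<lambda>S. 1 / (1 + sum r S) + (\<Sum>y\<in>A. of_bool (y \<in> S) * r y / (1 + sum r S)))"
    unfolding M_def by (subst Bochner_Integration.integral_add)
      (simp_all add: int Bochner_Integration.integral_sum del: of_bool_eq)
  also have "\<dots> = ?E A (\<lambda>S. 1)"
  proof (rule expectation_cong_pmf)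
    fix S assume "S \<in> set_pmf (random_subset A \<alpha>)"
    then have S: "S \<subseteq> A"
      using set_random_subset by auto
    have "(\<Sum>y\<in>A. of_bool (y \<in> S) * r y / (1 + sum r S)) = (\<Sum>y\<in>A. of_bool (y \<in> S) * r y) / (1 + sum r S)"
      by (simp add: sum_divide_distrib)
    also have "(\<Sum>y\<in>A. of_bool (y \<in> S) * r y) = sum r S"
      using S A by (intro sum.mono_neutral_cong_right) auto
    finally have "1 / (1 + sum r S) + (\<Sum>y\<in>A. of_bool (y \<in> S) * r y / (1 + sum r S)) =
        (1 + sum r S) / (1 + sum r S)"
      by (simp only: add_divide_distrib)
    also have "\<dots> = 1"
      using sum_nonneg[of S r] S r by (subst divide_self_if) force
    finally show "1 / (1 + sum r S) + (\<Sum>y\<in>A. of_bool (y \<in> S) * r y / (1 + sum r S)) = 1" .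
  qed
  finally show ?thesis
    by (simp add: M_def)
qed

text \<open>The map t / (1 + t) is subadditive: shrinking each denominator from
  \<open>1 + sum r S\<close> to \<open>1 + r y\<close> leaves a sum over \<open>S\<close>, and
  linearity of expectation gives every \<open>y\<close> the factor \<open>\<alpha>\<close>.\<close>

lemma expectation_weight_le:
  fixes r :: "'a \<Rightarrow> real"
  assumes A: "finite A" and \<alpha>: "0 \<le> \<alpha>" "\<alpha> \<le> 1" and r: "\<And>y. y \<in> A \<Longrightarrow> r y \<ge> 0"
  shows "measure_pmf.expectation (random_subset A \<alpha>) (\<lambda>S. sum r S / (1 + sum r S)) \<le>
    \<alpha> * (\<Sum>y\<in>A. r y / (1 + r y))"
proof -
  let ?E = "\<lambda>B. measure_pmf.expectation (random_subset B \<alpha>)"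
  have "?E A (\<lambda>S. sum r S / (1 + sum r S)) \<le> ?E A (\<lambda>S. \<Sum>y\<in>S. r y / (1 + r y))"
  proof (intro expectation_mono_finite finite_set_random_subset A)
    fix S assume "S \<in> set_pmf (random_subset A \<alpha>)"
    then have S: "S \<subseteq> A" "finite S"
      using set_random_subset[of A \<alpha>] A by (auto intro: finite_subset)
    have "r y / (1 + sum r S) \<le> r y / (1 + r y)" if "y \<in> S" for y
    proof -
      have "r y \<ge> 0" "r y \<le> sum r S"
        using S r that by (auto intro!: member_le_sum)
      then show ?thesis
        by (intro divide_left_mono) auto
    qed
    then show "sum r S / (1 + sum r S) \<le> (\<Sum>y\<in>S. r y / (1 + r y))"
      unfolding sum_divide_distrib by (intro sum_mono)
  qed
  also have "\<dots> = \<alpha> * (\<Sum>y\<in>A. r y / (1 + r y))"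
    using A
  proof (induction A rule: finite_induct)
    case empty
    then show ?case
      by (simp add: random_subset_def)
  next
    case (insert z A)
    have "?E A (\<lambda>S. \<Sum>y\<in>insert z S. r y / (1 + r y)) = ?E A (\<lambda>S. r z / (1 + r z) + (\<Sum>y\<in>S. r y / (1 + r y)))"
    proof (rule expectation_cong_pmf)
      fix S assume "S \<in> set_pmf (random_subset A \<alpha>)"
      then have "S \<subseteq> A"
        using set_random_subset by auto
      then show "(\<Sum>y\<in>insert z S. r y / (1 + r y)) = r z / (1 + r z) + (\<Sum>y\<in>S. r y / (1 + r y))"
        using insert by (intro sum.insert) (auto intro: finite_subset)
    qed
    also have "\<dots> = r z / (1 + r z) + ?E A (\<lambda>S. \<Sum>y\<in>S. r y / (1 + r y))"
      using insert by (subst Bochner_Integration.integral_add)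
        (auto simp: integrable_measure_pmf_finite finite_set_random_subset)
    finally show ?case
      using insert \<alpha> by (simp add: expectation_random_subset_insert algebra_simps)
  qed
  finally show ?thesis .
qed

section \<open>Sequential composition of sampling algorithms\<close>

primrec bind_alg :: "'a cond_alg \<Rightarrow> (real \<Rightarrow> 'a cond_alg) \<Rightarrow> 'a cond_alg" where
  "bind_alg (Output r) f = f r"
| "bind_alg (Sample_fst A k) f = Sample_fst A (\<lambda>x. bind_alg (k x) f)"
| "bind_alg (Sample_snd A k) f = Sample_snd A (\<lambda>x. bind_alg (k x) f)"
| "bind_alg (Random p k) f = Random p (\<lambda>i. bind_alg (k i) f)"

text \<open>Correctness is argued on this marginal alone and the number of samples through
  \<open>query_bound\<close>; the two meet only in the final theorem.\<close>

definition result :: "('a set \<Rightarrow> 'a pmf) \<Rightarrow> ('a set \<Rightarrow> 'a pmf) \<Rightarrow> 'a cond_alg \<Rightarrow> real pmf" where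
  "result M T a = map_pmf fst (run M T a)"

lemma result_simps [simp]:
  "result M T (Output r) = return_pmf r"
  "result M T (Sample_fst A k) = bind_pmf (M A) (\<lambda>x. result M T (k x))"
  "result M T (Sample_snd A k) = bind_pmf (T A) (\<lambda>x. result M T (k x))"
  "result M T (Random p k') = bind_pmf p (\<lambda>i. result M T (k' i))"
  by (simp_all add: result_def map_bind_pmf map_pmf_comp apsnd_def map_prod_def case_prod_beta)

lemma result_bind_alg [simp]:
  "result M T (bind_alg a f) = bind_pmf (result M T a) (\<lambda>r. result M T (f r))"
  by (induction a) (simp_all add: bind_return_pmf bind_assoc_pmf)

text \<open>A worst case over all answers and coin values, possible or not, and hence independent of
  the oracles.\<close>

primrec query_bound :: "'a cond_alg \<Rightarrow> nat \<Rightarrow> bool" where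
  "query_bound (Output r) = (\<lambda>n. True)"
| "query_bound (Sample_fst A k) = (\<lambda>n. n > 0 \<and> (\<forall>x. query_bound (k x) (n - 1)))"
| "query_bound (Sample_snd A k) = (\<lambda>n. n > 0 \<and> (\<forall>x. query_bound (k x) (n - 1)))"
| "query_bound (Random p k) = (\<lambda>n. \<forall>i. query_bound (k i) n)"

lemma query_bound_run:
  "query_bound a n \<Longrightarrow> (v, q) \<in> set_pmf (run M T a) \<Longrightarrow> q \<le> n"
proof (induction a arbitrary: n q)
  case (Sample_fst A k)
  then obtain x q' where "q = Suc q'" "(v, q') \<in> set_pmf (run M T (k x))"
    by auto
  with Sample_fst show ?case
    by (fastforce dest!: spec[of _ x])
next
  case (Sample_snd A k)
  then obtain x q' where "q = Suc q'" "(v, q') \<in> set_pmf (run M T (k x))"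
    by auto
  with Sample_snd show ?case
    by (fastforce dest!: spec[of _ x])
next
  case (Random p k)
  then show ?case
    by simp (meson rangeI)
qed auto

lemma query_bound_mono: "query_bound a n \<Longrightarrow> n \<le> m \<Longrightarrow> query_bound a m"
proof (induction a arbitrary: n m)
  case (Sample_fst A k)
  then show ?case
    by simp (meson diff_le_mono rangeI)
next
  case (Sample_snd A k)
  then show ?case
    by simp (meson diff_le_mono rangeI)
next
  case (Random p k)
  then show ?case
    by simp (meson rangeI)
qed auto

lemma query_bound_bind_alg:
  "query_bound a n \<Longrightarrow> (\<And>r. query_bound (f r) m) \<Longrightarrow> query_bound (bind_alg a f) (n + m)"
proof (induction a arbitrary: n)
  case (Output r)
  then show ?case
    by (simp add: query_bound_mono[where n = m])
next
  case (Sample_fst A k)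
  have "query_bound (bind_alg (k x) f) (n - 1 + m)" for x
    using Sample_fst.IH[of "k x" "n - 1"] Sample_fst.prems by simp
  with Sample_fst.prems show ?case
    by simp
next
  case (Sample_snd A k)
  have "query_bound (bind_alg (k x) f) (n - 1 + m)" for x
    using Sample_snd.IH[of "k x" "n - 1"] Sample_snd.prems by simp
  with Sample_snd.prems show ?case
    by simp
qed auto

definition sample :: "bool \<Rightarrow> 'a set \<Rightarrow> ('a \<Rightarrow> 'a cond_alg) \<Rightarrow> 'a cond_alg" where
  "sample b = (if b then Sample_fst else Sample_snd)"

lemma result_sample [simp]:
  "result M T (sample b A k) = bind_pmf ((if b then M else T) A) (\<lambda>x. result M T (k x))"
  by (simp add: sample_def)

lemma query_bound_sample [simp]:
  "query_bound (sample b A k) n \<longleftrightarrow> n > 0 \<and> (\<forall>x. query_bound (k x) (n - 1))"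
  by (simp add: sample_def)

section \<open>Sums of independent runs and their concentration\<close>

primrec repeat_sum :: "nat \<Rightarrow> 'a cond_alg \<Rightarrow> 'a cond_alg" where
  "repeat_sum 0 a = Output 0"
| "repeat_sum (Suc n) a = bind_alg a (\<lambda>r. bind_alg (repeat_sum n a) (\<lambda>s. Output (r + s)))"

lemma query_bound_repeat_sum:
  assumes "query_bound a q"
  shows "query_bound (repeat_sum n a) (n * q)"
proof (induction n)
  case (Suc n)
  have "query_bound (bind_alg (repeat_sum n a) (\<lambda>s. Output (r + s))) (n * q)" for r
    using query_bound_bind_alg[OF Suc, where m = 0] by simp
  from query_bound_bind_alg[OF assms this] show ?case
    by simp
qed simp

text \<open>Runs are independent, so the cross term \<open>2 * (r - m) * (s - n * m)\<close> has
  expectation 0 and second central moments add up. The vanishing first moment is carried along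
  because the induction needs it for exactly this term.\<close>

lemma repeat_sum_moments:
  assumes fin: "finite (set_pmf (result M T a))"
    and m: "m = measure_pmf.expectation (result M T a) (\<lambda>r. r)"
    and v: "measure_pmf.expectation (result M T a) (\<lambda>r. (r - m)\<^sup>2) \<le> v"
  shows "finite (set_pmf (result M T (repeat_sum n a))) \<and>
    measure_pmf.expectation (result M T (repeat_sum n a)) (\<lambda>s. s - n * m) = 0 \<and>
    measure_pmf.expectation (result M T (repeat_sum n a)) (\<lambda>s. (s - n * m)\<^sup>2) \<le> n * v"
proof (induction n)
  case (Suc n)
  let ?P = "result M T a" and ?S = "result M T (repeat_sum n a)"
  have intP: "integrable ?P f" and intS: "integrable ?S f" for f :: "real \<Rightarrow> real"
    using fin Suc by (auto intro!: integrable_measure_pmf_finite)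
  have E: "measure_pmf.expectation (result M T (repeat_sum (Suc n) a)) h =
      measure_pmf.expectation ?P (\<lambda>r. measure_pmf.expectation ?S (\<lambda>s. h (r + s)))" for h :: "real \<Rightarrow> real"
    using fin Suc by (simp add: expectation_bind_finite)
  have "measure_pmf.expectation ?S (\<lambda>s. r + s - real (Suc n) * m) =
      measure_pmf.expectation ?S (\<lambda>s. (r - m) + (s - n * m))" for r
    by (simp add: algebra_simps)
  also have "\<dots> r = r - m" for r
    using Suc by (subst Bochner_Integration.integral_add) (auto simp: intS)
  finally have 1: "measure_pmf.expectation (result M T (repeat_sum (Suc n) a)) (\<lambda>s. s - real (Suc n) * m) = 0"
    unfolding E using m by (simp add: intP)
  have "measure_pmf.expectation ?S (\<lambda>s. (r + s - real (Suc n) * m)\<^sup>2) \<le> (r - m)\<^sup>2 + n * v" for r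
  proof -
    have "measure_pmf.expectation ?S (\<lambda>s. (r + s - real (Suc n) * m)\<^sup>2) =
        measure_pmf.expectation ?S (\<lambda>s. (r - m)\<^sup>2 + (2 * (r - m) * (s - n * m) + (s - n * m)\<^sup>2))"
      by (simp add: algebra_simps power2_eq_square)
    also have "\<dots> = (r - m)\<^sup>2 + (2 * (r - m) * measure_pmf.expectation ?S (\<lambda>s. s - n * m) +
        measure_pmf.expectation ?S (\<lambda>s. (s - n * m)\<^sup>2))"
      by (subst Bochner_Integration.integral_add, simp_all add: intS)+
    finally show ?thesis
      using Suc by simp
  qed
  then have "measure_pmf.expectation (result M T (repeat_sum (Suc n) a)) (\<lambda>s. (s - real (Suc n) * m)\<^sup>2) \<le>
      measure_pmf.expectation ?P (\<lambda>r. (r - m)\<^sup>2 + n * v)"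
    unfolding E by (intro expectation_mono_finite fin) auto
  also have "\<dots> = measure_pmf.expectation ?P (\<lambda>r. (r - m)\<^sup>2) + n * v"
    by (subst Bochner_Integration.integral_add) (auto simp: intP)
  also have "\<dots> \<le> real (Suc n) * v"
    using v by (simp add: algebra_simps)
  finally show ?case
    using 1 fin Suc by auto
qed simp

text \<open>Chebyshev's inequality, obtained from Markov's inequality for the squared deviation of
  the sum.\<close>

lemma repeat_sum_chebyshev:
  assumes fin: "finite (set_pmf (result M T a))"
    and m: "m = measure_pmf.expectation (result M T a) (\<lambda>r. r)"
    and v: "measure_pmf.expectation (result M T a) (\<lambda>r. (r - m)\<^sup>2) \<le> v"
    and "n > 0" "t > 0"
  shows "measure_pmf.prob (result M T (repeat_sum n a)) {s. \<not> \<bar>s / n - m\<bar> \<le> t} \<le> v / (real n * t\<^sup>2)"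
proof -
  let ?S = "result M T (repeat_sum n a)"
  note mom = repeat_sum_moments[OF fin m v, of n]
  have "measure_pmf.prob ?S {s. \<not> \<bar>s / n - m\<bar> \<le> t} \<le> measure_pmf.prob ?S {s. (s - real n * m)\<^sup>2 \<ge> (real n * t)\<^sup>2}"
  proof (intro measure_pmf.finite_measure_mono subsetI, simp_all)
    fix s assume "\<not> \<bar>s / n - m\<bar> \<le> t"
    then have "real n * t \<le> n * \<bar>s / n - m\<bar>"
      using assms by (intro mult_left_mono) auto
    also have "\<dots> = \<bar>s - real n * m\<bar>"
    proof -
      have "real n * \<bar>s / n - m\<bar> = \<bar>n * (s / n - m)\<bar>"
        by (simp add: abs_mult)
      also have "n * (s / n - m) = s - real n * m"
        using assms by (simp add: right_diff_distrib)
      finally show ?thesis .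
    qed
    finally show "(real n * t)\<^sup>2 \<le> (s - real n * m)\<^sup>2"
      using \<open>n > 0\<close> \<open>t > 0\<close> by (metis abs_le_square_iff abs_of_pos mult_pos_pos of_nat_0_less_iff)
  qed
  also have "\<dots> \<le> measure_pmf.expectation ?S (\<lambda>s. (s - real n * m)\<^sup>2) / (real n * t)\<^sup>2"
    using integral_Markov_inequality_measure[of ?S "\<lambda>s. (s - real n * m)\<^sup>2" UNIV "(real n * t)\<^sup>2"] assms mom
    by (simp add: integrable_measure_pmf_finite)
  also have "\<dots> \<le> real n * v / (real n * t)\<^sup>2"
    using mom by (intro divide_right_mono) auto
  also have "\<dots> = v / (real n * t\<^sup>2)"
    using assms by (simp add: field_simps power2_eq_square)
  finally show ?thesis .
qed

text \<open>On the unit interval r^2 is at most r. Keeping the factor \<open>m\<close> matters: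
  small probabilities are estimated up to a relative error, and for \<open>m = 0\<close> the
  estimate becomes exact.\<close>

lemma variance_unit_interval_le:
  fixes p :: "real pmf"
  assumes "finite (set_pmf p)" "set_pmf p \<subseteq> {0..1}"
  defines "m \<equiv> measure_pmf.expectation p (\<lambda>r. r)"
  shows "measure_pmf.expectation p (\<lambda>r. (r - m)\<^sup>2) \<le> m * (1 - m)"
proof -
  note int = integrable_measure_pmf_finite[OF assms(1)]
  have "measure_pmf.expectation p (\<lambda>r. (r - m)\<^sup>2) \<le> measure_pmf.expectation p (\<lambda>r. (1 - 2 * m) * r + m\<^sup>2)"
  proof (intro expectation_mono_finite assms(1))
    fix r assume "r \<in> set_pmf p"
    then have "r * r \<le> r * 1"
      using assms(2) by (intro mult_left_mono) auto
    then show "(r - m)\<^sup>2 \<le> (1 - 2 * m) * r + m\<^sup>2"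
      by (simp add: power2_eq_square algebra_simps)
  qed
  also have "\<dots> = (1 - 2 * m) * m + m\<^sup>2"
    by (subst Bochner_Integration.integral_add) (auto simp: int m_def)
  also have "\<dots> = m * (1 - m)"
    by (simp add: power2_eq_square algebra_simps)
  finally show ?thesis .
qed

section \<open>Estimating the density of a single element\<close>

definition compare_alg :: "bool \<Rightarrow> nat \<Rightarrow> nat \<Rightarrow> nat cond_alg" where
  "compare_alg b N x = sample b {1..N} (\<lambda>y. sample b {x, y} (\<lambda>z. Output (of_bool (z = x))))"

text \<open>\<open>Random\<close> draws natural numbers only, hence the encoding of the random subset.\<close>

definition hit_alg :: "bool \<Rightarrow> nat \<Rightarrow> nat \<Rightarrow> real \<Rightarrow> nat cond_alg" where
  "hit_alg b N x \<alpha> = Random (map_pmf set_encode (random_subset {1..N} \<alpha>))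
     (\<lambda>i. if x \<in> set_decode i then Output 1
          else sample b (insert x (set_decode i)) (\<lambda>y. Output (of_bool (y \<noteq> x))))"

text \<open>Best of three, with the third run only on disagreement. An error probability d becomes
  at most 3 d^2, so the errors along the search sum to order 1 / c^2 instead of 1 / c; a window of
  ratio about \<open>1 / \<kappa>\<close> then suffices for failure probability of order
  \<open>\<kappa>\<close>.\<close>

definition majority_alg :: "'a cond_alg \<Rightarrow> 'a cond_alg" where
  "majority_alg a = bind_alg a (\<lambda>r. bind_alg a (\<lambda>s. if r = s then Output r else a))"

text \<open>Binary search for an exponent where the hit probability turns from high to low. A
  majority of hits means that the density is still large, so the search moves to larger exponents.
  The argument \<open>k\<close> bounds the depth, as the gap \<open>hi - lo\<close> halves in each
  round.\<close>

primrec density_search :: "bool \<Rightarrow> nat \<Rightarrow> nat \<Rightarrow> nat \<Rightarrow> nat \<Rightarrow> nat \<Rightarrow> nat cond_alg" where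
  "density_search b N x 0 lo hi = Output ((1 / 2) ^ lo)"
| "density_search b N x (Suc k) lo hi =
     (if hi \<le> lo + 1 then Output ((1 / 2) ^ lo)
      else bind_alg (majority_alg (hit_alg b N x ((1 / 2) ^ ((lo + hi) div 2))))
        (\<lambda>r. if r = 1 then density_search b N x k ((lo + hi) div 2) hi
             else density_search b N x k lo ((lo + hi) div 2)))"

lemma query_bound_compare_alg: "query_bound (compare_alg b N x) 2"
  by (simp add: compare_alg_def)

lemma query_bound_hit_alg: "query_bound (hit_alg b N x \<alpha>) 1"
  by (simp add: hit_alg_def)

lemma query_bound_majority_alg:
  assumes "query_bound a n"
  shows "query_bound (majority_alg a) (3 * n)"
proof -
  have "query_bound (bind_alg a (\<lambda>s. if r = s then Output r else a)) (n + n)" for r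
    using assms by (intro query_bound_bind_alg) auto
  from query_bound_bind_alg[OF assms this] have "query_bound (majority_alg a) (n + (n + n))"
    by (simp add: majority_alg_def)
  moreover have "n + (n + n) = 3 * n"
    by simp
  ultimately show ?thesis
    by metis
qed

lemma query_bound_density_search: "query_bound (density_search b N x k lo hi) (3 * k)"
proof (induction k arbitrary: lo hi)
  case (Suc k)
  have "query_bound (if r = 1 then density_search b N x k ((lo + hi) div 2) hi
      else density_search b N x k lo ((lo + hi) div 2)) (3 * k)" for r :: real
    using Suc by simp
  from query_bound_bind_alg[OF query_bound_majority_alg[OF query_bound_hit_alg] this] show ?case
    by simp
qed simp

lemma pmf_bind_return_of_bool:
  "pmf (bind_pmf p (\<lambda>z. return_pmf (of_bool (Q z) :: real))) 1 = measure_pmf.prob p {z. Q z}"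
proof -
  have "pmf (bind_pmf p (\<lambda>z. return_pmf (of_bool (Q z) :: real))) 1 =
      measure_pmf.expectation p (indicator {z. Q z})"
    unfolding pmf_bind by (intro expectation_cong_pmf) (auto simp: indicator_def)
  then show ?thesis
    by simp
qed

lemma expectation_zero_one:
  fixes p :: "real pmf"
  assumes "set_pmf p \<subseteq> {0, 1}"
  shows "measure_pmf.expectation p (\<lambda>r. r) = pmf p 1"
  using assms by (subst integral_measure_pmf[of "{0, 1}"]) auto

text \<open>If a single run returns 1 with probability \<open>h\<close>, the majority does so with
  probability \<open>h\<^sup>2 * (3 - 2 * h)\<close>; the second bound is the same with
  \<open>1 - h\<close> for \<open>h\<close>.\<close>

lemma majority_prob_le:
  assumes "set_pmf (result M T a) \<subseteq> {0, 1}"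
  shows "measure_pmf.prob (result M T (majority_alg a)) {r. r = 1} \<le> 3 * (pmf (result M T a) 1)\<^sup>2"
    and "measure_pmf.prob (result M T (majority_alg a)) {r. r \<noteq> 1} \<le> 3 * (1 - pmf (result M T a) 1)\<^sup>2"
proof -
  define h where "h = pmf (result M T a) 1"
  have h: "0 \<le> h" "h \<le> 1"
    by (auto simp: h_def pmf_le_1)
  have P: "result M T a = map_pmf of_bool (bernoulli_pmf h)"
    unfolding h_def by (rule zero_one_pmf_eq_bernoulli[OF assms])
  have map: "bind_pmf (map_pmf of_bool (bernoulli_pmf h)) f =
      bind_pmf (bernoulli_pmf h) (\<lambda>b. f (of_bool b))" for f :: "real \<Rightarrow> real pmf"
    by (simp add: bind_map_pmf)
  have m: "measure_pmf.prob (map_pmf of_bool (bernoulli_pmf h)) A =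
      indicator A (1 :: real) * h + indicator A 0 * (1 - h)" for A
  proof -
    have "measure_pmf.prob (map_pmf of_bool (bernoulli_pmf h)) A =
        measure_pmf.expectation (map_pmf of_bool (bernoulli_pmf h)) (indicator A)"
      by simp
    also have "\<dots> = indicator A (1 :: real) * h + indicator A 0 * (1 - h)"
      unfolding integral_map_pmf using h by (simp add: of_bool_def)
    finally show ?thesis .
  qed
  have "measure_pmf.prob (result M T (majority_alg a)) {r. r = 1} = h\<^sup>2 * (3 - 2 * h)"
    unfolding majority_alg_def result_bind_alg P map using h
    by (simp add: prob_bind_pmf P m measure_return_pmf algebra_simps power2_eq_square del: measure_map_pmf)
  also have "\<dots> \<le> h\<^sup>2 * 3"
    using h by (intro mult_left_mono) auto
  finally show "measure_pmf.prob (result M T (majority_alg a)) {r. r = 1} \<le> 3 * (pmf (result M T a) 1)\<^sup>2"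
    by (simp add: h_def)
  have "measure_pmf.prob (result M T (majority_alg a)) {r. r \<noteq> 1} = (1 - h)\<^sup>2 * (1 + 2 * h)"
    unfolding majority_alg_def result_bind_alg P map using h
    by (simp add: prob_bind_pmf P m measure_return_pmf algebra_simps power2_eq_square del: measure_map_pmf)
  also have "\<dots> \<le> (1 - h)\<^sup>2 * 3"
    using h by (intro mult_left_mono) auto
  finally show "measure_pmf.prob (result M T (majority_alg a)) {r. r \<noteq> 1} \<le> 3 * (1 - pmf (result M T a) 1)\<^sup>2"
    by (simp add: h_def)
qed

text \<open>
  For \<open>pmf \<nu> x > 0\<close>, the factor turning \<open>pmf \<nu> x\<close> into the probability
  that \<open>x\<close> wins the comparison with an independent sample from \<open>\<nu>\<close>.
\<close>

definition spread :: "nat \<Rightarrow> nat pmf \<Rightarrow> nat \<Rightarrow> real" where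
  "spread N \<nu> x = 1 + (\<Sum>y\<in>{1..N} - {x}. pmf \<nu> y / (pmf \<nu> x + pmf \<nu> y))"

definition win_prob :: "nat \<Rightarrow> nat pmf \<Rightarrow> nat \<Rightarrow> real" where
  "win_prob N \<nu> x = pmf \<nu> x * spread N \<nu> x"

section \<open>Win and hit probabilities of the two basic tests\<close>

text \<open>The flag \<open>b\<close> selects the oracle that answers for \<open>\<nu>\<close>, so
  that one analysis serves both distributions.\<close>

locale cond_oracle =
  fixes N :: nat and \<nu> :: "nat pmf" and M T :: "nat set \<Rightarrow> nat pmf" and b :: bool and x :: nat
  assumes support: "set_pmf \<nu> \<subseteq> {1..N}"
    and is_orc: "cond_sampling_oracle {1..N} \<nu> (if b then M else T)"
    and x: "x \<in> {1..N}"
begin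

abbreviation orc :: "nat set \<Rightarrow> nat pmf" where
  "orc \<equiv> if b then M else T"

lemma orc_eq_cond_pmf:
  assumes "A \<subseteq> {1..N}" "y \<in> A" "pmf \<nu> y > 0"
  shows "orc A = cond_pmf \<nu> A"
proof -
  have "measure_pmf.prob \<nu> A > 0"
    using assms by (intro measure_pmf_posI[of y]) (auto simp: set_pmf_iff)
  then show ?thesis
    using is_orc assms unfolding cond_sampling_oracle_def by blast
qed

lemma pmf_orc:
  assumes "A \<subseteq> {1..N}" "y \<in> A" "pmf \<nu> y > 0" "z \<in> A"
  shows "pmf (orc A) z = pmf \<nu> z / sum (pmf \<nu>) A"
proof -
  have "y \<in> set_pmf \<nu>"
    using assms by (simp add: set_pmf_iff)
  then have "set_pmf \<nu> \<inter> A \<noteq> {}"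
    using assms by blast
  then show ?thesis
    using assms finite_subset[OF assms(1)]
    by (simp add: orc_eq_cond_pmf[OF assms(1-3)] pmf_cond measure_measure_pmf_finite)
qed

lemma orc_UNIV: "orc {1..N} = \<nu>"
proof -
  have "measure_pmf.prob \<nu> {1..N} = 1"
    using support by (subst measure_pmf.prob_eq_1) (auto simp: AE_measure_pmf_iff)
  moreover from this have "orc {1..N} = cond_pmf \<nu> {1..N}"
    using is_orc x unfolding cond_sampling_oracle_def by force
  moreover have "set_pmf \<nu> \<inter> {1..N} \<noteq> {}"
    using support set_pmf_not_empty[of \<nu>] by auto
  ultimately show ?thesis
    using support by (intro pmf_eqI) (auto simp: pmf_cond pmf_eq_0_set_pmf)
qed

lemma set_compare_alg: "set_pmf (result M T (compare_alg b N x)) \<subseteq> {0, 1}"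
  by (auto simp: compare_alg_def)

text \<open>A sampled \<open>y\<close> has positive mass, so the query \<open>{x, y}\<close> is
  never conditioned on a null set, even if \<open>pmf \<nu> x = 0\<close>. The draw
  \<open>y = x\<close> makes \<open>x\<close> win with certainty and yields the summand 1 of
  \<open>spread\<close>.\<close>

lemma pmf_compare_alg: "pmf (result M T (compare_alg b N x)) 1 = win_prob N \<nu> x"
proof -
  have "pmf (result M T (compare_alg b N x)) 1 =
      measure_pmf.expectation \<nu> (\<lambda>y. pmf (orc {x, y}) x)"
    unfolding compare_alg_def result_sample result_simps orc_UNIV pmf_bind[of \<nu>] pmf_bind_return_of_bool
    by (simp add: measure_pmf_single)
  also have "\<dots> = (\<Sum>y\<in>{1..N}. pmf \<nu> y *\<^sub>R pmf (orc {x, y}) x)"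
    using support by (intro integral_measure_pmf) auto
  also have "\<dots> = (\<Sum>y\<in>{1..N}. pmf \<nu> x * (if y = x then 1 else pmf \<nu> y / (pmf \<nu> x + pmf \<nu> y)))"
  proof (intro sum.cong refl)
    fix y assume y: "y \<in> {1..N}"
    show "pmf \<nu> y *\<^sub>R pmf (orc {x, y}) x =
        pmf \<nu> x * (if y = x then 1 else pmf \<nu> y / (pmf \<nu> x + pmf \<nu> y))"
    proof (cases "pmf \<nu> y = 0")
      case False
      then have "pmf \<nu> y > 0"
        by (simp add: order_less_le)
      then show ?thesis
        using pmf_orc[of "{x, y}" y x] x y by (auto simp: mult.commute)
    qed auto
  qed
  also have "\<dots> = win_prob N \<nu> x"
    using x by (simp add: win_prob_def spread_def sum_distrib_left[symmetric] sum.remove[of _ x])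
  finally show ?thesis .
qed

lemma spread_ge_1: "spread N \<nu> x \<ge> 1"
  by (auto simp: spread_def intro!: sum_nonneg)

lemma spread_le: "spread N \<nu> x \<le> N"
proof -
  have "(\<Sum>y\<in>{1..N} - {x}. pmf \<nu> y / (pmf \<nu> x + pmf \<nu> y)) \<le> (\<Sum>y\<in>{1..N} - {x}. 1)"
  proof (rule sum_mono)
    fix y
    show "pmf \<nu> y / (pmf \<nu> x + pmf \<nu> y) \<le> 1"
      by (cases "pmf \<nu> x + pmf \<nu> y = 0") (auto simp: divide_le_eq_1 less_le)
  qed
  also have "\<dots> = real N - 1"
    using x by (simp add: of_nat_diff)
  finally show ?thesis
    by (simp add: spread_def)
qed

lemma set_hit_alg: "set_pmf (result M T (hit_alg b N x \<alpha>)) \<subseteq> {0, 1}"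
  by (auto simp: hit_alg_def split: if_splits)

lemma result_hit_alg:
  "result M T (hit_alg b N x \<alpha>) = bind_pmf (random_subset {1..N} \<alpha>)
     (\<lambda>S. if x \<in> S then return_pmf 1
          else bind_pmf (orc (insert x S)) (\<lambda>y. return_pmf (of_bool (y \<noteq> x))))"
proof -
  have dec: "set_decode (set_encode S) = S" if "S \<in> set_pmf (random_subset {1..N} \<alpha>)" for S
    using that set_random_subset[of "{1..N}" \<alpha>] by (intro set_encode_inverse) (auto intro: finite_subset)
  show ?thesis
    unfolding hit_alg_def by (auto simp: bind_map_pmf dec intro!: bind_pmf_cong)
qed

text \<open>In units of \<open>pmf \<nu> x\<close>, a query \<open>insert x S\<close> with
  \<open>x \<notin> S\<close> misses \<open>x\<close> with probability
  \<open>sum r S / (1 + sum r S)\<close>. Averaging over \<open>S\<close> gives \<open>H\<close>,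
  which the two expectation bounds for random subsets enclose.\<close>

lemma pmf_hit_alg_bounds:
  assumes \<nu>x: "pmf \<nu> x > 0" and \<alpha>: "0 \<le> \<alpha>" "\<alpha> \<le> 1"
  defines "D \<equiv> \<alpha> * spread N \<nu> x"
  shows "D / (1 + D) \<le> pmf (result M T (hit_alg b N x \<alpha>)) 1"
    and "pmf (result M T (hit_alg b N x \<alpha>)) 1 \<le> D"
proof -
  define A where "A = {1..N} - {x}"
  have A: "finite A" "x \<notin> A" "{1..N} = insert x A"
    using x by (auto simp: A_def)
  define r where "r y = pmf \<nu> y / pmf \<nu> x" for y
  have r: "r y \<ge> 0" for y
    by (simp add: r_def)
  have fr: "r y / (1 + r y) = pmf \<nu> y / (pmf \<nu> x + pmf \<nu> y)" for y
    using \<nu>x by (simp add: r_def field_simps)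
  define D' where "D' = \<alpha> * (\<Sum>y\<in>A. r y / (1 + r y))"
  have D: "D = \<alpha> + D'"
    by (simp add: D_def D'_def spread_def fr A_def algebra_simps)
  have D': "D' \<ge> 0" "D' \<ge> \<alpha> * D'"
  proof -
    show "D' \<ge> 0"
      using \<alpha> r by (auto simp: D'_def intro!: mult_nonneg_nonneg sum_nonneg)
    then show "D' \<ge> \<alpha> * D'"
      using \<alpha> by (intro mult_left_le_one_le) auto
  qed
  let ?E = "measure_pmf.expectation (random_subset A \<alpha>)"
  define H where "H = ?E (\<lambda>S. sum r S / (1 + sum r S))"
  define g where "g S = (if x \<in> S then 1 else measure_pmf.prob (orc (insert x S)) {y. y \<noteq> x})" for S
  have hit: "pmf (result M T (hit_alg b N x \<alpha>)) 1 = measure_pmf.expectation (random_subset {1..N} \<alpha>) g"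
    unfolding result_hit_alg pmf_bind
    by (intro expectation_cong_pmf) (auto simp: g_def pmf_bind_return_of_bool)
  also have "\<dots> = \<alpha> * ?E (\<lambda>S. g (insert x S)) + (1 - \<alpha>) * ?E g"
    unfolding A(3) using A \<alpha> by (intro expectation_random_subset_insert)
  also have "?E g = H"
    unfolding H_def
  proof (rule expectation_cong_pmf)
    fix S assume "S \<in> set_pmf (random_subset A \<alpha>)"
    then have S: "S \<subseteq> A" "x \<notin> S" "finite S" "insert x S \<subseteq> {1..N}"
      using set_random_subset[of A \<alpha>] A by (auto intro: finite_subset)
    have "g S = 1 - pmf (orc (insert x S)) x"
    proof -
      have "measure_pmf.prob (orc (insert x S)) {y. y \<noteq> x} =
          measure_pmf.prob (orc (insert x S)) (UNIV - {x})"
        by (rule arg_cong[where f = "measure_pmf.prob _"]) auto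
      also have "\<dots> = 1 - measure_pmf.prob (orc (insert x S)) {x}"
        using measure_pmf.prob_compl[of "{x}" "orc (insert x S)"] by simp
      finally show ?thesis
        using S by (simp add: g_def measure_pmf_single)
    qed
    also have "pmf (orc (insert x S)) x = pmf \<nu> x / (pmf \<nu> x + sum (pmf \<nu>) S)"
      using S \<nu>x pmf_orc[of "insert x S" x x] by auto
    also have "sum (pmf \<nu>) S = pmf \<nu> x * sum r S"
      using \<nu>x by (simp add: r_def sum_distrib_left)
    also have "1 - pmf \<nu> x / (pmf \<nu> x + pmf \<nu> x * sum r S) = sum r S / (1 + sum r S)"
    proof -
      have "sum r S \<ge> 0"
        using r by (intro sum_nonneg) auto
      moreover have *: "pmf \<nu> x + pmf \<nu> x * sum r S = pmf \<nu> x * (1 + sum r S)"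
        by (simp add: algebra_simps)
      have "pmf \<nu> x / (pmf \<nu> x + pmf \<nu> x * sum r S) = 1 / (1 + sum r S)"
        unfolding * using \<nu>x by simp
      ultimately show ?thesis
        by (simp add: field_simps)
    qed
    finally show "g S = sum r S / (1 + sum r S)" .
  qed
  \<comment> \<open>A random set containing \<open>x\<close> counts as a hit; this accounts for the
    summand 1 of \<open>spread\<close>.\<close>
  also have "?E (\<lambda>S. g (insert x S)) = 1"
    by (simp add: g_def)
  finally have h: "pmf (result M T (hit_alg b N x \<alpha>)) 1 = \<alpha> + (1 - \<alpha>) * H"
    by simp
  have "H \<le> D'"
    unfolding H_def D'_def using A \<alpha> r by (intro expectation_weight_le)
  then have "(1 - \<alpha>) * H \<le> (1 - \<alpha>) * D'"
    using \<alpha> by (intro mult_left_mono) auto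
  also have "\<dots> \<le> D'"
    using \<alpha> D' by (simp add: algebra_simps)
  finally show "pmf (result M T (hit_alg b N x \<alpha>)) 1 \<le> D"
    by (simp add: h D)
  have fin: "finite (set_pmf (random_subset A \<alpha>))"
    using A by (intro finite_set_random_subset)
  have "?E (\<lambda>S. 1 / (1 + sum r S)) = ?E (\<lambda>S. 1 - sum r S / (1 + sum r S))"
  proof (rule expectation_cong_pmf)
    fix S
    have "sum r S \<ge> 0"
      using r by (intro sum_nonneg) auto
    then show "1 / (1 + sum r S) = 1 - sum r S / (1 + sum r S)"
      by (simp add: field_simps)
  qed
  also have "\<dots> = 1 - H"
    unfolding H_def by (subst Bochner_Integration.integral_diff)
      (auto intro!: integrable_measure_pmf_finite fin)
  finally have "(1 - H) * (1 + D') \<le> 1"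
    using expectation_inverse_weight_le[of A \<alpha> r] A \<alpha> r by (simp add: D'_def)
  then have "1 - H \<le> 1 / (1 + D')"
    using D' by (simp add: field_simps)
  then have "(1 - \<alpha>) * (1 - H) \<le> (1 - \<alpha>) * (1 / (1 + D'))"
    using \<alpha> by (intro mult_left_mono) auto
  \<comment> \<open>With \<open>D = \<alpha> + D'\<close> this amounts to
    \<open>(1 - \<alpha>) * (1 + \<alpha> + D') \<le> 1 + D'\<close>.\<close>
  also have "\<dots> \<le> 1 / (1 + D)"
    using D' \<alpha> by (simp add: D field_simps)
  finally show "D / (1 + D) \<le> pmf (result M T (hit_alg b N x \<alpha>)) 1"
    using D' \<alpha> by (simp add: h D field_simps)
qed

end

section \<open>Accumulated error of the binary search\<close>

text \<open>A geometric sum of ratio 4 whose largest term is at most \<open>3 / c\<^sup>2\<close>.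
  The correction \<open>- 1 / D\<^sup>2\<close> closes the induction: halving \<open>D\<close> turns
  it into \<open>- 4 / D\<^sup>2\<close>, which absorbs the new term
  \<open>3 / D\<^sup>2\<close>.\<close>

lemma sum_large_terms_le:
  fixes c D :: real
  assumes "c > 0" "D > 0"
  shows "(\<Sum>i<n. if D / 2 ^ i \<ge> c then 3 / (D / 2 ^ i)\<^sup>2 else 0) \<le>
    (if D \<ge> c then 4 / c\<^sup>2 - 1 / D\<^sup>2 else 0)"
  using assms(2)
proof (induction n arbitrary: D)
  case (Suc n)
  have "(\<Sum>i<Suc n. if D / 2 ^ i \<ge> c then 3 / (D / 2 ^ i)\<^sup>2 else 0) =
      (if D \<ge> c then 3 / D\<^sup>2 else 0) + (\<Sum>i<n. if D / 2 / 2 ^ i \<ge> c then 3 / (D / 2 / 2 ^ i)\<^sup>2 else 0)"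
    by (subst sum.lessThan_Suc_shift) (simp cong: if_cong)
  also have "\<dots> \<le> (if D \<ge> c then 3 / D\<^sup>2 else 0) + (if D / 2 \<ge> c then 4 / c\<^sup>2 - 1 / (D / 2)\<^sup>2 else 0)"
    using Suc by (intro add_left_mono Suc.IH) auto
  also have "\<dots> \<le> (if D \<ge> c then 4 / c\<^sup>2 - 1 / D\<^sup>2 else 0)"
  proof (cases "D \<ge> c")
    case True
    then have "c\<^sup>2 \<le> D\<^sup>2"
      using assms by (intro power_mono) auto
    then have "4 / D\<^sup>2 \<le> 4 / c\<^sup>2"
      using assms by (intro frac_le) auto
    then show ?thesis
      using True by (simp add: power_divide)
  qed (use assms Suc in auto)
  finally show ?case .
next
  case 0
  have "1 / D\<^sup>2 \<le> 4 / c\<^sup>2" if "D \<ge> c"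
  proof -
    have "c\<^sup>2 \<le> D\<^sup>2"
      using assms that by (intro power_mono) auto
    then show ?thesis
      using assms by (intro frac_le) auto
  qed
  then show ?case
    by simp
qed

text \<open>Here the terms decrease by the factor 4. The induction closes because
  \<open>3 * D\<^sup>2 + 4 * (D / 2)\<^sup>2 = 4 * D\<^sup>2\<close>.\<close>

lemma sum_small_terms_le:
  fixes c D :: real
  assumes "c > 0" "D > 0"
  shows "(\<Sum>i<n. if D / 2 ^ i \<le> 1 / c then 3 * (D / 2 ^ i)\<^sup>2 else 0) \<le>
    4 * (if D \<le> 1 / c then D\<^sup>2 else (1 / c)\<^sup>2)"
  using assms(2)
proof (induction n arbitrary: D)
  case (Suc n)
  have "(\<Sum>i<Suc n. if D / 2 ^ i \<le> 1 / c then 3 * (D / 2 ^ i)\<^sup>2 else 0) =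
      (if D \<le> 1 / c then 3 * D\<^sup>2 else 0) + (\<Sum>i<n. if D / 2 / 2 ^ i \<le> 1 / c then 3 * (D / 2 / 2 ^ i)\<^sup>2 else 0)"
    by (subst sum.lessThan_Suc_shift) (simp cong: if_cong)
  also have "\<dots> \<le> (if D \<le> 1 / c then 3 * D\<^sup>2 else 0) + 4 * (if D / 2 \<le> 1 / c then (D / 2)\<^sup>2 else (1 / c)\<^sup>2)"
    using Suc by (intro add_left_mono Suc.IH) auto
  also have "\<dots> \<le> 4 * (if D \<le> 1 / c then D\<^sup>2 else (1 / c)\<^sup>2)"
  proof (cases "D \<le> 1 / c")
    case False
    then show ?thesis
      using Suc.prems assms by (auto intro!: power_mono)
  qed (use Suc.prems in \<open>auto simp: power_divide\<close>)
  finally show ?case .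
qed auto

text \<open>Bounds the probability that the majority test misleads the search at a density with
  \<open>\<alpha> * spread N \<nu> x = D\<close>. Strictly between \<open>1 / c\<close> and
  \<open>c\<close> either answer is acceptable, so nothing is charged.\<close>

definition search_error :: "real \<Rightarrow> real \<Rightarrow> real" where
  "search_error c D = (if D \<ge> c then 3 / D\<^sup>2 else 0) + (if D \<le> 1 / c then 3 * D\<^sup>2 else 0)"

lemma search_error_nonneg: "search_error c D \<ge> 0"
  by (simp add: search_error_def)

lemma sum_search_error_le:
  assumes "c > 0" "D > 0"
  shows "(\<Sum>i<n. search_error c (D / 2 ^ i)) \<le> 8 / c\<^sup>2"
proof -
  have "(if D \<ge> c then 4 / c\<^sup>2 - 1 / D\<^sup>2 else 0) \<le> 4 / c\<^sup>2"
    by simp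
  moreover have "4 * (if D \<le> 1 / c then D\<^sup>2 else (1 / c)\<^sup>2) \<le> 4 / c\<^sup>2"
  proof (cases "D \<le> 1 / c")
    case True
    then have "D\<^sup>2 \<le> (1 / c)\<^sup>2"
      using assms by (intro power_mono) auto
    then show ?thesis
      using True by (simp add: power_divide)
  qed (simp add: power_divide)
  ultimately show ?thesis
    using sum_large_terms_le[OF assms, of n] sum_small_terms_le[OF assms, of n]
    by (simp add: search_error_def sum.distrib)
qed

context cond_oracle
begin

text \<open>
  Every density is tested at most once, so the errors at the densities outside the target window
  add up to a geometric sum that does not depend on the length of the search.
\<close>

lemma density_search_fail:
  assumes \<nu>x: "pmf \<nu> x > 0" and c: "c > 1"
  shows "hi - lo \<le> 2 ^ k \<Longrightarrow> lo \<le> hi \<Longrightarrow> spread N \<nu> x / 2 ^ lo > 1 / c \<Longrightarrow> spread N \<nu> x / 2 ^ hi < c \<Longrightarrow>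
    measure_pmf.prob (result M T (density_search b N x k lo hi))
      {\<alpha>. \<not> (0 < \<alpha> \<and> \<alpha> \<le> 1 \<and> 1 / c < \<alpha> * spread N \<nu> x \<and> \<alpha> * spread N \<nu> x < 2 * c)} \<le>
    (\<Sum>i\<in>{lo<..<hi}. search_error c (spread N \<nu> x / 2 ^ i))"
proof (induction k arbitrary: lo hi)
  case 0
  let ?bad = "{\<alpha>. \<not> (0 < \<alpha> \<and> \<alpha> \<le> 1 \<and> 1 / c < \<alpha> * spread N \<nu> x \<and> \<alpha> * spread N \<nu> x < 2 * c)}"
  \<comment> \<open>Since \<open>hi \<le> lo + 1\<close>, the value at \<open>lo\<close> is at most
    twice the value at \<open>hi\<close>. This is where the upper end \<open>2 * c\<close> of the
    target window comes from.\<close>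
  have "spread N \<nu> x / 2 ^ (lo + 1) \<le> spread N \<nu> x / 2 ^ hi"
    using 0 spread_ge_1 by (intro divide_left_mono power_increasing) auto
  then have "(1 / 2) ^ lo \<notin> ?bad"
    using 0 by (simp add: power_divide power_le_one)
  then show ?case
    by (simp add: measure_return_pmf indicator_def sum_nonneg search_error_nonneg)
next
  case (Suc k)
  let ?F = "spread N \<nu> x"
  let ?bad = "{\<alpha>. \<not> (0 < \<alpha> \<and> \<alpha> \<le> 1 \<and> 1 / c < \<alpha> * ?F \<and> \<alpha> * ?F < 2 * c)}"
  let ?err = "\<lambda>i. search_error c (?F / 2 ^ i)"
  show ?case
  proof (cases "hi \<le> lo + 1")
    case True
    have "?F / 2 ^ (lo + 1) \<le> ?F / 2 ^ hi"
      using True spread_ge_1 by (intro divide_left_mono power_increasing) auto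
    then have "(1 / 2) ^ lo \<notin> ?bad"
      using Suc.prems by (simp add: power_divide power_le_one)
    then show ?thesis
      using True by (simp add: measure_return_pmf indicator_def sum_nonneg search_error_nonneg)
  next
    case False
    define m where "m = (lo + hi) div 2"
    have m: "lo < m" "m < hi" "hi - m \<le> 2 ^ k" "m - lo \<le> 2 ^ k"
      using False Suc.prems(1) by (auto simp: m_def)
    define D where "D = ?F / 2 ^ m"
    have D: "D > 0"
      using spread_ge_1 by (auto simp: D_def)
    define P where "P = result M T (majority_alg (hit_alg b N x ((1 / 2) ^ m)))"
    define h where "h = pmf (result M T (hit_alg b N x ((1 / 2) ^ m))) 1"
    have h: "D / (1 + D) \<le> h" "h \<le> D" "0 \<le> h" "h \<le> 1"
      using pmf_hit_alg_bounds[OF \<nu>x, of "(1 / 2) ^ m"]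
      by (auto simp: h_def D_def power_le_one power_divide pmf_le_1)
    have "1 - h \<le> 1 / (1 + D)"
      using h(1) D by (simp add: field_simps)
    also have "\<dots> \<le> 1 / D"
      using D by (intro divide_left_mono) auto
    finally have "(1 - h)\<^sup>2 \<le> (1 / D)\<^sup>2"
      using h by (intro power_mono) auto
    moreover have "measure_pmf.prob P {r. r \<noteq> 1} \<le> 3 * (1 - h)\<^sup>2"
      unfolding P_def h_def by (intro majority_prob_le set_hit_alg)
    ultimately have P_ne: "measure_pmf.prob P {r. r \<noteq> 1} \<le> 3 / D\<^sup>2"
      by (simp add: power_divide)
    have "h\<^sup>2 \<le> D\<^sup>2"
      using h by (intro power_mono) auto
    moreover have "measure_pmf.prob P {r. r = 1} \<le> 3 * h\<^sup>2"
      unfolding P_def h_def by (intro majority_prob_le set_hit_alg)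
    ultimately have P_eq: "measure_pmf.prob P {r. r = 1} \<le> 3 * D\<^sup>2"
      by simp
    let ?L = "density_search b N x k lo m" and ?H = "density_search b N x k m hi"
    let ?f = "\<lambda>r. result M T (if r = 1 then ?H else ?L)"
    have H: "measure_pmf.prob (result M T ?H) ?bad \<le> (\<Sum>i\<in>{m<..<hi}. ?err i)" if "D > 1 / c"
      using m that Suc.prems by (intro Suc.IH) (auto simp: D_def)
    have L: "measure_pmf.prob (result M T ?L) ?bad \<le> (\<Sum>i\<in>{lo<..<m}. ?err i)" if "D < c"
      using m that Suc.prems by (intro Suc.IH) (auto simp: D_def)
    have split: "(\<Sum>i\<in>{lo<..<hi}. ?err i) = (\<Sum>i\<in>{lo<..<m}. ?err i) + (?err m + (\<Sum>i\<in>{m<..<hi}. ?err i))"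
    proof -
      have "{lo<..<hi} = {lo<..<m} \<union> insert m {m<..<hi}"
        using m by auto
      then show ?thesis
        by (simp add: sum.union_disjoint disjoint_iff)
    qed
    have nonneg: "(\<Sum>i\<in>{u<..<v}. ?err i) \<ge> 0" for u v
      by (intro sum_nonneg search_error_nonneg)
    have c1: "1 / c < c"
      using c by (simp add: divide_less_eq) (smt (verit) mult_less_cancel_left1)
    have res: "result M T (density_search b N x (Suc k) lo hi) = bind_pmf P ?f"
      using False by (simp add: P_def m_def cong: if_cong)
    \<comment> \<open>For \<open>D \<ge> c\<close> or \<open>D \<le> 1 / c\<close> only one of the
      recursive calls keeps the invariant, and a wrong test result is charged to the error at
      \<open>m\<close>. In between, both calls keep it and the test result is irrelevant.\<close>
    consider "D \<ge> c" | "D \<le> 1 / c" | "1 / c < D" "D < c"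
      by linarith
    then show ?thesis
    proof cases
      case 1
      then have "?err m \<ge> 3 / D\<^sup>2"
        by (auto simp: search_error_def D_def)
      moreover have "measure_pmf.prob (bind_pmf P ?f) ?bad \<le> 3 / D\<^sup>2 + (\<Sum>i\<in>{m<..<hi}. ?err i)"
        using 1 c1 P_ne H nonneg by (intro prob_bind_union_bound[where Q = "\<lambda>r. r = 1"]) auto
      ultimately show ?thesis
        unfolding res split using nonneg[of lo m] by linarith
    next
      case 2
      then have "?err m \<ge> 3 * D\<^sup>2"
        by (auto simp: search_error_def D_def)
      moreover have "measure_pmf.prob (bind_pmf P ?f) ?bad \<le> 3 * D\<^sup>2 + (\<Sum>i\<in>{lo<..<m}. ?err i)"
        using 2 c1 P_eq L nonneg by (intro prob_bind_union_bound[where Q = "\<lambda>r. r \<noteq> 1"]) auto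
      ultimately show ?thesis
        unfolding res split using nonneg[of m hi] by linarith
    next
      case 3
      have "measure_pmf.prob (bind_pmf P ?f) ?bad \<le> 0 + (\<Sum>i\<in>{lo<..<hi}. ?err i)"
      proof (intro prob_bind_union_bound[where Q = "\<lambda>r. True"])
        fix r
        show "measure_pmf.prob (?f r) ?bad \<le> (\<Sum>i\<in>{lo<..<hi}. ?err i)"
          using 3 H L split nonneg[of lo m] nonneg[of m hi] search_error_nonneg[of c "?F / 2 ^ m"]
          by auto
      qed (use nonneg in auto)
      then show ?thesis
        unfolding res by simp
    qed
  qed
qed

end

text \<open>
  A successful search leaves \<open>\<alpha> * spread N \<nu> x\<close> between \<open>sqrt \<kappa>\<close> and \<open>2 / sqrt \<kappa>\<close>. The
  rescaling brings it between \<open>\<kappa>\<^sup>2 / 2\<close> and \<open>\<kappa>\<close>, where it agrees with the hit probability up to a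
  factor \<open>1 + \<kappa>\<close>.
\<close>

definition density_alg :: "bool \<Rightarrow> nat \<Rightarrow> nat \<Rightarrow> nat \<Rightarrow> nat \<Rightarrow> real \<Rightarrow> nat \<Rightarrow> nat cond_alg" where
  "density_alg b k L N n \<kappa> x = bind_alg (density_search b N x k 0 L) (\<lambda>\<alpha>.
     bind_alg (repeat_sum n (compare_alg b N x)) (\<lambda>g.
     bind_alg (repeat_sum n (hit_alg b N x (\<alpha> * (\<kappa> * sqrt \<kappa> / 2)))) (\<lambda>h.
       Output (if g / n < \<kappa> then 0 else \<alpha> * (\<kappa> * sqrt \<kappa> / 2) * (g / n) / (h / n)))))"

lemma query_bound_density_alg: "query_bound (density_alg b k L N n \<kappa> x) (3 * k + 3 * n)"
proof -
  have "query_bound (density_alg b k L N n \<kappa> x) (3 * k + (n * 2 + (n * 1 + 0)))"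
    unfolding density_alg_def
    by (intro query_bound_bind_alg query_bound_density_search query_bound_repeat_sum
        query_bound_compare_alg query_bound_hit_alg) simp
  moreover have "3 * k + (n * 2 + (n * 1 + 0)) = 3 * k + 3 * n"
    by simp
  ultimately show ?thesis
    by metis
qed

section \<open>Accuracy of the density estimate\<close>

text \<open>Since \<open>\<nu> = G / F\<close>, the true value is the estimate times the two ratios
  \<open>G / g\<close> and \<open>h / (\<alpha> * F)\<close>. The first is within
  \<open>\<kappa>\<close> of 1 because an absolute error \<open>\<kappa>\<^sup>2\<close> is relative
  \<open>\<kappa>\<close> for \<open>g \<ge> \<kappa>\<close>; the second lies between
  \<open>(1 - \<kappa>) / (1 + \<kappa>)\<close> and \<open>1 + \<kappa>\<close>.\<close>

lemma density_estimate_error: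
  fixes \<nu> \<alpha> F G g h p \<kappa> :: real
  assumes \<kappa>: "0 < \<kappa>" "\<kappa> < 1" and pos: "\<alpha> > 0" "F > 0" and G: "G = \<nu> * F"
    and g: "\<bar>g - G\<bar> \<le> \<kappa>\<^sup>2" "g \<ge> \<kappa>"
    and p: "\<alpha> * F / (1 + \<alpha> * F) \<le> p" "p \<le> \<alpha> * F" "\<alpha> * F \<le> \<kappa>"
    and h: "\<bar>h - p\<bar> \<le> \<kappa> * p"
  shows "\<bar>\<nu> - \<alpha> * g / h\<bar> \<le> 3 * \<kappa> * (\<alpha> * g / h)"
proof -
  define D where "D = \<alpha> * F"
  have D: "D > 0"
    using pos by (simp add: D_def)
  have "D / (1 + D) > 0"
    using D by simp
  then have "p > 0"
    using p by (simp add: D_def)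
  have gpos: "g > 0"
    using g \<kappa> by linarith
  have "\<kappa> * p < p"
    using \<open>p > 0\<close> \<kappa> by simp
  then have hpos: "h > 0"
    using h by linarith
  define a where "a = G / g"
  define d where "d = h / D"
  have "\<kappa>\<^sup>2 \<le> \<kappa> * g"
    using g \<kappa> by (simp add: power2_eq_square)
  then have "\<bar>G - g\<bar> \<le> \<kappa> * g"
    using g by linarith
  then have a: "1 - \<kappa> \<le> a" "a \<le> 1 + \<kappa>"
    using gpos by (auto simp: a_def field_simps abs_le_iff)
  have "D / (1 + D) \<ge> D / (1 + \<kappa>)"
    using D p by (intro divide_left_mono) (auto simp: D_def)
  then have "p \<ge> D / (1 + \<kappa>)"
    using p by (simp add: D_def)
  then have "(1 - \<kappa>) * (D / (1 + \<kappa>)) \<le> (1 - \<kappa>) * p"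
    using \<kappa> by (intro mult_left_mono) auto
  also have "\<dots> \<le> h"
    using h by (simp add: algebra_simps abs_le_iff)
  finally have d1: "(1 - \<kappa>) / (1 + \<kappa>) \<le> d"
    using D \<kappa> by (simp add: d_def field_simps)
  have "h \<le> (1 + \<kappa>) * p"
    using h by (simp add: algebra_simps abs_le_iff)
  also have "\<dots> \<le> (1 + \<kappa>) * D"
    using p \<kappa> by (intro mult_left_mono) (auto simp: D_def)
  finally have d2: "d \<le> 1 + \<kappa>"
    using D by (simp add: d_def field_simps)
  have dpos: "d > 0"
    using hpos D by (simp add: d_def)
  have "a * d \<le> (1 + \<kappa>) * (1 + \<kappa>)"
    using a d2 dpos \<kappa> by (intro mult_mono) auto
  also have "\<dots> \<le> 1 + 3 * \<kappa>"
    using \<kappa> by (simp add: algebra_simps mult_left_le)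
  finally have 1: "a * d \<le> 1 + 3 * \<kappa>" .
  have "(1 - 3 * \<kappa>) * (1 + \<kappa>) \<le> (1 - \<kappa>) * (1 - \<kappa>)"
    using \<kappa> by (simp add: algebra_simps)
  then have "1 - 3 * \<kappa> \<le> (1 - \<kappa>) * ((1 - \<kappa>) / (1 + \<kappa>))"
    using \<kappa> by (simp add: field_simps)
  also have "\<dots> \<le> a * d"
    using a d1 \<kappa> by (intro mult_mono) auto
  finally have 2: "1 - 3 * \<kappa> \<le> a * d" .
  define e where "e = \<alpha> * g / h"
  have e: "e > 0"
    using pos gpos hpos by (simp add: e_def)
  have "e * (a * d) = \<nu>"
    using pos gpos hpos by (simp add: e_def a_def d_def D_def G)
  then have "\<nu> - e = e * (a * d - 1)"
    by (simp add: algebra_simps)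
  then have "\<bar>\<nu> - e\<bar> = e * \<bar>a * d - 1\<bar>"
    using e by (simp add: abs_mult)
  also have "\<dots> \<le> e * (3 * \<kappa>)"
    using 1 2 e by (intro mult_left_mono) auto
  also have "\<dots> = 3 * \<kappa> * e"
    by simp
  finally show ?thesis
    unfolding e_def .
qed

text \<open>The origin of the exponent 5: both Chebyshev bounds below are a constant times
  \<open>1 / (n * \<kappa> ^ 4)\<close> and have to be of order \<open>\<kappa>\<close>.\<close>

lemma inverse_mult_power4_le:
  fixes \<kappa> :: real
  assumes "0 < \<kappa>" "real n \<ge> 1 / \<kappa> ^ 5"
  shows "1 / (n * \<kappa> ^ 4) \<le> \<kappa>"
proof -
  have "n * \<kappa> ^ 5 \<ge> 1"
    using assms by (simp add: field_simps)
  then have "1 \<le> \<kappa> * (n * \<kappa> ^ 4)"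
    by (simp add: eval_nat_numeral algebra_simps)
  moreover have "n > 0"
    using assms by (cases n) (auto simp: field_simps)
  ultimately show ?thesis
    using assms by (simp add: divide_le_eq)
qed

text \<open>The failure budget is \<open>8 * \<kappa>\<close> for the search,
  \<open>\<kappa>\<close> for the comparisons and \<open>4 * \<kappa>\<close> for the hits. The
  output 0 means that the estimate of \<open>G\<close> fell below \<open>\<kappa>\<close>; as its
  error is at most \<open>\<kappa>\<^sup>2 \<le> \<kappa>\<close>, then
  \<open>G \<le> 2 * \<kappa>\<close>.\<close>

lemma (in cond_oracle) density_alg_fail:
  assumes \<kappa>: "0 < \<kappa>" "\<kappa> \<le> 1 / 6" and L: "N \<le> 2 ^ L" "L \<le> 2 ^ k" and n: "real n \<ge> 1 / \<kappa> ^ 5"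
  shows "measure_pmf.prob (result M T (density_alg b k L N n \<kappa> x))
    {e. \<not> ((e = 0 \<and> win_prob N \<nu> x \<le> 2 * \<kappa>) \<or> \<bar>pmf \<nu> x - e\<bar> \<le> 3 * \<kappa> * e)} \<le> 13 * \<kappa>"
proof -
  let ?bad = "{e. \<not> ((e = 0 \<and> win_prob N \<nu> x \<le> 2 * \<kappa>) \<or> \<bar>pmf \<nu> x - e\<bar> \<le> 3 * \<kappa> * e)}"
  let ?F = "spread N \<nu> x"
  have n0: "n > 0"
    using n \<kappa> by (cases n) (auto simp: field_simps)
  have ret: "measure_pmf.prob (return_pmf v) B \<le> 0" if "v \<notin> B" for v :: real and B
    using that by (simp add: measure_return_pmf)
  note n4 = inverse_mult_power4_le[OF \<kappa>(1) n]
  have \<kappa>2: "\<kappa>\<^sup>2 \<le> \<kappa>"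
    using \<kappa> by (simp add: power2_eq_square mult_left_le)
  define G where "G = win_prob N \<nu> x"
  have finC: "finite (set_pmf (result M T (compare_alg b N x)))"
    using set_compare_alg by (rule finite_subset) simp
  have EC: "G = measure_pmf.expectation (result M T (compare_alg b N x)) (\<lambda>r. r)"
    unfolding expectation_zero_one[OF set_compare_alg] pmf_compare_alg G_def ..
  have VC: "measure_pmf.expectation (result M T (compare_alg b N x)) (\<lambda>r. (r - G)\<^sup>2) \<le> G * (1 - G)"
    unfolding EC using finC set_compare_alg by (intro variance_unit_interval_le) auto
  note cheb = repeat_sum_chebyshev[OF finC EC VC n0]
  show ?thesis
  proof (cases "pmf \<nu> x = 0")
    \<comment> \<open>Hit queries may now have mass 0 and unspecified answers, so nothing is claimed
      about the search. The comparisons have mean and variance 0, so Chebyshev's bound is 0 and the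
      output is almost surely 0.\<close>
    case True
    then have G: "G = 0"
      by (simp add: G_def win_prob_def)
    have g: "measure_pmf.prob (result M T (repeat_sum n (compare_alg b N x))) {g. \<not> \<bar>g / n - G\<bar> \<le> \<kappa> / 2} \<le> 0"
      using cheb[of "\<kappa> / 2"] \<kappa> by (simp add: G)
    have "measure_pmf.prob (result M T (density_alg b k L N n \<kappa> x)) ?bad \<le> 0 + (0 + 0)"
      unfolding density_alg_def result_bind_alg
    proof (rule prob_bind_union_bound[where Q = "\<lambda>_. True"], simp, simp, rule prob_bind_union_bound[OF g], simp)
      fix \<alpha> g
      assume "\<bar>g / n - G\<bar> \<le> \<kappa> / 2"
      then have "g / n < \<kappa>"
        using \<kappa> G by linarith
      then show "measure_pmf.prob (bind_pmf (result M T (repeat_sum n (hit_alg b N x (\<alpha> * (\<kappa> * sqrt \<kappa> / 2)))))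
          (\<lambda>h. result M T (Output (if g / n < \<kappa> then 0
            else \<alpha> * (\<kappa> * sqrt \<kappa> / 2) * (g / n) / (h / n))))) ?bad \<le> 0"
        using G \<kappa> by (simp add: G_def measure_return_pmf)
    qed
    then show ?thesis
      using \<kappa> by simp
  next
    case False
    then have \<nu>x: "pmf \<nu> x > 0"
      by (simp add: order_less_le)
    define s where "s = sqrt \<kappa>"
    have s: "s > 0" "s * s = \<kappa>" "s < 1"
      using \<kappa> by (auto simp: s_def)
    \<comment> \<open>This choice turns the search failure bound \<open>8 / c\<^sup>2\<close> into
      \<open>8 * \<kappa>\<close>.\<close>
    define c where "c = 1 / s"
    have c: "c > 1" "8 / c\<^sup>2 = 8 * \<kappa>" "1 / c = s"
      using s by (auto simp: c_def power2_eq_square)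
    have F: "?F > 0" "?F \<ge> 1" "?F \<le> 2 ^ L"
      using spread_ge_1 spread_le L(1) by (auto simp: order.trans[OF spread_le] simp flip: of_nat_le_iff)
    have "1 * 2 ^ L < c * 2 ^ L"
      using c by (intro mult_strict_right_mono) auto
    then have FL: "?F < c * 2 ^ L"
      using F by linarith
    let ?Q = "\<lambda>\<alpha>. 0 < \<alpha> \<and> \<alpha> \<le> 1 \<and> 1 / c < \<alpha> * ?F \<and> \<alpha> * ?F < 2 * c"
    have "measure_pmf.prob (result M T (density_search b N x k 0 L)) {\<alpha>. \<not> ?Q \<alpha>} \<le>
        (\<Sum>i\<in>{0<..<L}. search_error c (?F / 2 ^ i))"
      using L F FL c s by (intro density_search_fail \<nu>x) (auto simp: divide_less_eq)
    also have "\<dots> \<le> (\<Sum>i<L. search_error c (?F / 2 ^ i))"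
      by (intro sum_mono2 search_error_nonneg) auto
    also have "\<dots> \<le> 8 * \<kappa>"
      using sum_search_error_le[of c ?F L] c F by simp
    finally have search: "measure_pmf.prob (result M T (density_search b N x k 0 L)) {\<alpha>. \<not> ?Q \<alpha>} \<le> 8 * \<kappa>" .
    have g: "measure_pmf.prob (result M T (repeat_sum n (compare_alg b N x))) {g. \<not> \<bar>g / n - G\<bar> \<le> \<kappa>\<^sup>2} \<le> \<kappa>"
    proof -
      have "measure_pmf.prob (result M T (repeat_sum n (compare_alg b N x))) {g. \<not> \<bar>g / n - G\<bar> \<le> \<kappa>\<^sup>2} \<le>
          G * (1 - G) / (n * (\<kappa>\<^sup>2)\<^sup>2)"
        using \<kappa> by (intro cheb) auto
      also have "\<dots> \<le> 1 / (n * (\<kappa>\<^sup>2)\<^sup>2)"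
      proof (intro divide_right_mono)
        have "0 \<le> G" "G \<le> 1"
          using pmf_compare_alg by (auto simp: G_def pmf_le_1 simp flip: pmf_compare_alg)
        then show "G * (1 - G) \<le> 1"
          by (intro mult_le_one) auto
      qed auto
      also have "\<dots> \<le> \<kappa>"
        using n4 by simp
      finally show ?thesis .
    qed
    have h: "measure_pmf.prob (result M T (repeat_sum n (hit_alg b N x \<alpha>')))
        {h. \<not> \<bar>h / n - pmf (result M T (hit_alg b N x \<alpha>')) 1\<bar> \<le> \<kappa> * pmf (result M T (hit_alg b N x \<alpha>')) 1} \<le> 4 * \<kappa>"
      if \<alpha>': "0 \<le> \<alpha>'" "\<alpha>' \<le> 1" "\<kappa>\<^sup>2 / 2 \<le> \<alpha>' * ?F" "\<alpha>' * ?F \<le> \<kappa>" for \<alpha>'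
    proof -
      let ?P = "result M T (hit_alg b N x \<alpha>')"
      define p where "p = pmf ?P 1"
      define D where "D = \<alpha>' * ?F"
      have D: "\<kappa>\<^sup>2 / 2 \<le> D" "0 < D" "D \<le> 1"
        using \<alpha>' \<kappa> by (auto simp: D_def intro: less_le_trans[of 0 "\<kappa>\<^sup>2 / 2"])
      have "\<kappa>\<^sup>2 / 4 \<le> D / 2"
        using D by simp
      also have "\<dots> \<le> D / (1 + D)"
        using D by (intro divide_left_mono) auto
      also have "\<dots> \<le> p"
        unfolding D_def p_def using \<alpha>' by (intro pmf_hit_alg_bounds \<nu>x)
      finally have p: "\<kappa>\<^sup>2 / 4 \<le> p" .
      moreover have "\<kappa>\<^sup>2 / 4 > 0"
        using \<kappa> by simp
      ultimately have p0: "p > 0"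
        by linarith
      have fin: "finite (set_pmf ?P)"
        using set_hit_alg by (rule finite_subset) simp
      have E: "p = measure_pmf.expectation ?P (\<lambda>r. r)"
        unfolding expectation_zero_one[OF set_hit_alg] p_def ..
      have V: "measure_pmf.expectation ?P (\<lambda>r. (r - p)\<^sup>2) \<le> p * (1 - p)"
        unfolding E using fin set_hit_alg[of \<alpha>'] by (intro variance_unit_interval_le) auto
      \<comment> \<open>The variance bound cancels one factor \<open>p\<close>, so the relative
        accuracy costs only a factor \<open>1 / p\<close>, which is at most
        \<open>4 / \<kappa>\<^sup>2\<close>.\<close>
      have "measure_pmf.prob (result M T (repeat_sum n (hit_alg b N x \<alpha>'))) {h. \<not> \<bar>h / n - p\<bar> \<le> \<kappa> * p} \<le>
          p * (1 - p) / (n * (\<kappa> * p)\<^sup>2)"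
        using \<kappa> p0 by (intro repeat_sum_chebyshev[OF fin E V n0]) auto
      also have "\<dots> \<le> p / (n * (\<kappa> * p)\<^sup>2)"
        using p0 by (intro divide_right_mono) (auto simp: algebra_simps)
      also have "\<dots> = 1 / (n * \<kappa>\<^sup>2 * p)"
        using p0 n0 \<kappa> by (subst frac_eq_eq) (auto simp: power2_eq_square)
      also have "\<dots> \<le> 1 / (n * \<kappa>\<^sup>2 * (\<kappa>\<^sup>2 / 4))"
        using p p0 n0 \<kappa> by (intro divide_left_mono mult_left_mono) auto
      also have "\<dots> = 4 * (1 / (n * \<kappa> ^ 4))"
        by (simp add: eval_nat_numeral)
      also have "\<dots> \<le> 4 * \<kappa>"
        using n4 by simp
      finally show ?thesis
        by (simp add: p_def)
    qed
    have "measure_pmf.prob (result M T (density_alg b k L N n \<kappa> x)) ?bad \<le> 8 * \<kappa> + (\<kappa> + (4 * \<kappa> + 0))"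
      unfolding density_alg_def result_bind_alg
    proof (intro prob_bind_union_bound[OF search] prob_bind_union_bound[OF g])
      fix \<alpha> g
      assume \<alpha>: "?Q \<alpha>" and g: "\<bar>g / n - G\<bar> \<le> \<kappa>\<^sup>2"
      define \<alpha>' where "\<alpha>' = \<alpha> * (\<kappa> * sqrt \<kappa> / 2)"
      have "\<kappa> * s \<le> 1"
        using \<kappa> s by (intro mult_le_one) auto
      then have \<alpha>'1: "0 < \<alpha>'" "\<alpha>' \<le> 1"
        using \<alpha> \<kappa> s(1) unfolding \<alpha>'_def s_def[symmetric]
        by (simp, intro mult_le_one) auto
      have D: "\<alpha>' * ?F = \<alpha> * ?F * (\<kappa> * s / 2)"
        by (simp add: \<alpha>'_def s_def)
      have "s * (\<kappa> * s / 2) \<le> \<alpha> * ?F * (\<kappa> * s / 2)"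
        using \<alpha> c s \<kappa> by (intro mult_right_mono) auto
      moreover have "s * (\<kappa> * s / 2) = \<kappa>\<^sup>2 / 2"
        using s by (simp add: power2_eq_square algebra_simps)
      ultimately have D1: "\<kappa>\<^sup>2 / 2 \<le> \<alpha>' * ?F"
        by (simp add: D)
      have "\<alpha> * ?F * (\<kappa> * s / 2) \<le> 2 * c * (\<kappa> * s / 2)"
        using \<alpha> s \<kappa> by (intro mult_right_mono) auto
      moreover have "2 * c * (\<kappa> * s / 2) = \<kappa>"
        using s by (simp add: c_def)
      ultimately have D2: "\<alpha>' * ?F \<le> \<kappa>"
        unfolding D by linarith
      note bounds = pmf_hit_alg_bounds[OF \<nu>x, of \<alpha>']
      have "measure_pmf.prob (bind_pmf (result M T (repeat_sum n (hit_alg b N x \<alpha>')))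
          (\<lambda>h. result M T (Output (if g / n < \<kappa> then 0 else \<alpha>' * (g / n) / (h / n))))) ?bad \<le> 4 * \<kappa> + 0"
      proof (intro prob_bind_union_bound[OF h])
        fix h
        assume h: "\<bar>h / n - pmf (result M T (hit_alg b N x \<alpha>')) 1\<bar> \<le> \<kappa> * pmf (result M T (hit_alg b N x \<alpha>')) 1"
        have "(if g / n < \<kappa> then 0 else \<alpha>' * (g / n) / (h / n)) \<notin> ?bad"
        proof (cases "g / n < \<kappa>")
          case True
          then have "G \<le> 2 * \<kappa>"
            using g \<kappa>2 by linarith
          then show ?thesis
            using True by (simp add: G_def)
        next
          case False
          have "\<bar>pmf \<nu> x - \<alpha>' * (g / n) / (h / n)\<bar> \<le> 3 * \<kappa> * (\<alpha>' * (g / n) / (h / n))"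
            by (rule density_estimate_error[where F = ?F and G = G, OF _ _ _ _ _ g _ _ _ _ h])
              (use \<kappa> \<alpha>'1 F D2 bounds False in \<open>auto simp: G_def win_prob_def\<close>)
          then show ?thesis
            using False by auto
        qed
        then show "measure_pmf.prob (result M T
            (Output (if g / n < \<kappa> then 0 else \<alpha>' * (g / n) / (h / n)))) ?bad \<le> 0"
          unfolding result_simps by (rule ret)
      qed (use \<alpha>'1 D1 D2 in auto)
      then show "measure_pmf.prob (bind_pmf (result M T (repeat_sum n (hit_alg b N x (\<alpha> * (\<kappa> * sqrt \<kappa> / 2)))))
          (\<lambda>h. result M T (Output (if g / n < \<kappa> then 0 else \<alpha> * (\<kappa> * sqrt \<kappa> / 2) * (g / n) / (h / n))))) ?bad \<le> 4 * \<kappa> + 0"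
        unfolding \<alpha>'_def .
    qed (use \<kappa> in auto)
    then show ?thesis
      by simp
  qed
qed

lemma (in cond_oracle) finite_result_density_search:
  "finite (set_pmf (result M T (density_search b N x k lo hi)))"
proof (induction k arbitrary: lo hi)
  case (Suc k)
  have "finite (set_pmf (result M T (hit_alg b N x \<alpha>)))" for \<alpha>
    using set_hit_alg by (rule finite_subset) simp
  with Suc show ?case
    by (auto simp: majority_alg_def)
qed simp

lemma finite_result_repeat_sum:
  "finite (set_pmf (result M T a)) \<Longrightarrow> finite (set_pmf (result M T (repeat_sum n a)))"
  by (induction n) auto

lemma (in cond_oracle) finite_result_density_alg:
  "finite (set_pmf (result M T (density_alg b k L N n \<kappa> x)))"
proof -
  have "finite (set_pmf (result M T (hit_alg b N x \<alpha>)))" for \<alpha>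
    using set_hit_alg by (rule finite_subset) simp
  moreover have "finite (set_pmf (result M T (compare_alg b N x)))"
    using set_compare_alg by (rule finite_subset) simp
  ultimately show ?thesis
    by (auto simp: density_alg_def finite_result_density_search finite_result_repeat_sum)
qed

section \<open>Estimating the total variation distance\<close>

text \<open>Let \<open>z\<close> be a heaviest element of the set. It wins against each other member
  with probability at least 1/2, so \<open>win_prob N \<nu> z\<close> is at least half the mass of
  the set.\<close>

lemma sum_pmf_small_win_prob_le:
  assumes "g \<ge> 0"
  shows "(\<Sum>x\<in>{x\<in>{1..N}. win_prob N \<nu> x \<le> g}. pmf \<nu> x) \<le> 2 * g"
proof -
  define B where "B = {x\<in>{1..N}. win_prob N \<nu> x \<le> g}"
  have B: "finite B" "B \<subseteq> {1..N}"
    by (auto simp: B_def)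
  show ?thesis
  proof (cases "B = {}")
    case True
    then show ?thesis
      using assms unfolding B_def[symmetric] by simp
  next
    case False
    then have "Max (pmf \<nu> ` B) \<in> pmf \<nu> ` B"
      using B by (intro Max_in) auto
    then obtain z where z: "z \<in> B" "Max (pmf \<nu> ` B) = pmf \<nu> z"
      by auto
    have le: "pmf \<nu> y \<le> pmf \<nu> z" if "y \<in> B" for y
      using B that by (simp flip: z(2))
    have "(\<Sum>y\<in>B - {z}. pmf \<nu> y / 2) \<le> (\<Sum>y\<in>B - {z}. pmf \<nu> z * (pmf \<nu> y / (pmf \<nu> z + pmf \<nu> y)))"
    proof (rule sum_mono)
      fix y assume "y \<in> B - {z}"
      then have y: "pmf \<nu> y \<le> pmf \<nu> z"
        using le by auto
      show "pmf \<nu> y / 2 \<le> pmf \<nu> z * (pmf \<nu> y / (pmf \<nu> z + pmf \<nu> y))"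
      proof (cases "pmf \<nu> y = 0")
        case False
        then have "pmf \<nu> y > 0"
          by (simp add: order_less_le)
        then show ?thesis
          using y by (simp add: field_simps)
      qed simp
    qed
    also have "\<dots> \<le> (\<Sum>y\<in>{1..N} - {z}. pmf \<nu> z * (pmf \<nu> y / (pmf \<nu> z + pmf \<nu> y)))"
      using B by (intro sum_mono2) auto
    also have "\<dots> = win_prob N \<nu> z - pmf \<nu> z"
      by (simp add: win_prob_def spread_def sum_distrib_left algebra_simps)
    also have "win_prob N \<nu> z \<le> g"
      using z by (simp add: B_def)
    finally have "(\<Sum>y\<in>B - {z}. pmf \<nu> y) + 2 * pmf \<nu> z \<le> 2 * g"
      by (simp add: sum_divide_distrib[symmetric])
    moreover have "(\<Sum>y\<in>B. pmf \<nu> y) = pmf \<nu> z + (\<Sum>y\<in>B - {z}. pmf \<nu> y)"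
      using z B by (intro sum.remove)
    ultimately show ?thesis
      unfolding B_def[symmetric] using pmf_nonneg[of \<nu> z] by linarith
  qed
qed

text \<open>For a ratio of masses this is the positive part of \<open>1 - \<rho>\<close>. The clamp
  from above keeps the output in the unit interval whatever real number the estimates produce,
  including \<open>t / 0 = 0\<close>.\<close>

definition excess :: "real \<Rightarrow> real" where
  "excess \<rho> = max 0 (min 1 (1 - \<rho>))"

lemma excess_bounds: "0 \<le> excess \<rho>" "excess \<rho> \<le> 1"
  by (auto simp: excess_def)

text \<open>With \<open>d = 3 * \<kappa>\<close>, the ratios \<open>r\<close> and
  \<open>\<rho>\<close> differ by at most \<open>d * (r + \<rho>)\<close>. For
  \<open>\<rho> \<le> 1\<close> this forces \<open>r \<le> 3\<close> and the difference is at most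
  \<open>4 * d\<close>; for larger \<open>\<rho>\<close> the clipped value is 0 and \<open>r\<close>
  can fall below 1 only by \<open>2 * d\<close>.\<close>

lemma excess_ratio_error:
  fixes \<mu> \<tau> u t \<kappa> :: real
  assumes \<kappa>: "0 \<le> \<kappa>" "\<kappa> \<le> 1 / 6" and \<mu>: "\<mu> > 0" and \<tau>: "\<tau> \<ge> 0"
    and u: "\<bar>\<mu> - u\<bar> \<le> 3 * \<kappa> * u" and t: "\<bar>\<tau> - t\<bar> \<le> 3 * \<kappa> * t"
  shows "\<bar>excess (t / u) - excess (\<tau> / \<mu>)\<bar> \<le> 12 * \<kappa>"
proof -
  define d where "d = 3 * \<kappa>"
  have d: "0 \<le> d" "d \<le> 1 / 2"
    using \<kappa> by (auto simp: d_def)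
  have ub: "(1 - d) * u \<le> \<mu>" "\<mu> \<le> (1 + d) * u" and tb: "(1 - d) * t \<le> \<tau>" "\<tau> \<le> (1 + d) * t"
    using u t by (auto simp: d_def abs_le_iff algebra_simps)
  have u0: "u > 0"
    using ub(2) \<mu> d by (smt (verit) mult_nonneg_nonpos)
  have t0: "t \<ge> 0"
    using tb(2) \<tau> d by (smt (verit) mult_pos_neg)
  define r where "r = t / u"
  define \<rho> where "\<rho> = \<tau> / \<mu>"
  have r0: "r \<ge> 0" and \<rho>0: "\<rho> \<ge> 0"
    using t0 u0 \<mu> \<tau> by (auto simp: r_def \<rho>_def)
  have "((1 - d) * t) * \<mu> \<le> \<tau> * ((1 + d) * u)"
    using ub tb \<mu> \<tau> d u0 by (intro mult_mono) auto
  then have 1: "(1 - d) * r \<le> (1 + d) * \<rho>"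
    using u0 \<mu> by (simp add: r_def \<rho>_def field_simps)
  have "\<tau> * ((1 - d) * u) \<le> ((1 + d) * t) * \<mu>"
    using ub tb \<mu> \<tau> d u0 t0 by (intro mult_mono) auto
  then have 2: "(1 - d) * \<rho> \<le> (1 + d) * r"
    using u0 \<mu> by (simp add: r_def \<rho>_def field_simps)
  have "\<bar>excess r - excess \<rho>\<bar> \<le> 4 * d"
  proof (cases "\<rho> \<le> 1")
    case True
    have "1 / 2 * r \<le> (1 - d) * r"
      using d r0 by (intro mult_right_mono) auto
    also note 1
    also have "(1 + d) * \<rho> \<le> 3 / 2 * 1"
      using d True \<rho>0 by (intro mult_mono) auto
    finally have "r \<le> 3"
      by simp
    then have "d * (r + \<rho>) \<le> d * 4"
      using d True by (intro mult_left_mono) auto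
    moreover have "\<bar>r - \<rho>\<bar> \<le> d * (r + \<rho>)"
      using 1 2 by (simp add: abs_le_iff algebra_simps)
    ultimately show ?thesis
      by (auto simp: excess_def max_def min_def)
  next
    case False
    have "(1 - d) * 1 \<le> (1 - d) * \<rho>"
      using False d by (intro mult_left_mono) auto
    also note 2
    finally have "1 - r \<le> d * (1 + r)"
      by (simp add: algebra_simps)
    moreover have "d * (1 + r) \<le> d * 2" if "r \<le> 1"
      using d that by (intro mult_left_mono) auto
    ultimately show ?thesis
      using False d by (auto simp: excess_def max_def min_def)
  qed
  then show ?thesis
    by (simp add: d_def r_def \<rho>_def)
qed

text \<open>The deviation never exceeds 1 on the unit interval, so the bad event adds at most its
  probability.\<close>

lemma expectation_close:
  fixes p :: "real pmf"
  assumes fin: "finite (set_pmf p)" and "set_pmf p \<subseteq> {0..1}" "0 \<le> w" "w \<le> 1" "0 \<le> \<beta>"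
    and bad: "measure_pmf.prob p {v. \<not> \<bar>v - w\<bar> \<le> \<beta>} \<le> \<delta>"
  shows "\<bar>measure_pmf.expectation p (\<lambda>v. v) - w\<bar> \<le> \<beta> + \<delta>"
proof -
  note int = integrable_measure_pmf_finite[OF fin]
  have "measure_pmf.expectation p (\<lambda>v. v) - w = measure_pmf.expectation p (\<lambda>v. v - w)"
    by (subst Bochner_Integration.integral_diff) (auto simp: int)
  then have "\<bar>measure_pmf.expectation p (\<lambda>v. v) - w\<bar> \<le> measure_pmf.expectation p (\<lambda>v. \<bar>v - w\<bar>)"
    using integral_abs_bound[of p "\<lambda>v. v - w"] by simp
  also have "\<dots> \<le> measure_pmf.expectation p (\<lambda>v. \<beta> + indicator {v. \<not> \<bar>v - w\<bar> \<le> \<beta>} v)"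
  proof (intro expectation_mono_finite fin)
    fix v assume "v \<in> set_pmf p"
    then have "\<bar>v - w\<bar> \<le> 1"
      using assms by (force simp: abs_le_iff)
    then show "\<bar>v - w\<bar> \<le> \<beta> + indicator {v. \<not> \<bar>v - w\<bar> \<le> \<beta>} v"
      using \<open>0 \<le> \<beta>\<close> by (auto simp: indicator_def)
  qed
  also have "\<dots> = \<beta> + measure_pmf.prob p {v. \<not> \<bar>v - w\<bar> \<le> \<beta>}"
    by (subst Bochner_Integration.integral_add) (auto simp: int)
  finally show ?thesis
    using bad by linarith
qed

definition excess_alg :: "nat \<Rightarrow> nat \<Rightarrow> nat \<Rightarrow> nat \<Rightarrow> real \<Rightarrow> nat \<Rightarrow> nat cond_alg" where
  "excess_alg k L N n \<kappa> x = bind_alg (density_alg True k L N n \<kappa> x) (\<lambda>u.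
     bind_alg (density_alg False k L N n \<kappa> x) (\<lambda>t. Output (excess (t / u))))"

definition tv_sample_alg :: "nat \<Rightarrow> nat \<Rightarrow> nat \<Rightarrow> nat \<Rightarrow> real \<Rightarrow> nat cond_alg" where
  "tv_sample_alg k L N n \<kappa> = Sample_fst {1..N} (excess_alg k L N n \<kappa>)"

lemma query_bound_tv_sample_alg:
  "query_bound (tv_sample_alg k L N n \<kappa>) (1 + 6 * k + 6 * n)"
proof -
  have "query_bound (excess_alg k L N n \<kappa> x) ((3 * k + 3 * n) + ((3 * k + 3 * n) + 0))" for x
    unfolding excess_alg_def by (intro query_bound_bind_alg query_bound_density_alg) simp
  moreover have "(3 * k + 3 * n) + ((3 * k + 3 * n) + 0) = 6 * k + 6 * n"
    by simp
  ultimately have "query_bound (excess_alg k L N n \<kappa> x) (6 * k + 6 * n)" for x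
    by metis
  then show ?thesis
    by (simp add: tv_sample_alg_def)
qed

text \<open>The absolute value of a difference is twice its positive part minus the difference, and
  the differences sum to 0. For \<open>pmf \<mu> x = 0\<close> the ratio defaults to 0, but its
  weight vanishes.\<close>

lemma d_TV_eq_sum_excess:
  fixes N :: nat
  assumes "set_pmf \<mu> \<subseteq> {1..N}" "set_pmf \<tau> \<subseteq> {1..N}"
  shows "d_TV {1..N} \<mu> \<tau> = (\<Sum>x\<in>{1..N}. pmf \<mu> x * excess (pmf \<tau> x / pmf \<mu> x))"
proof -
  have "(\<Sum>x\<in>{1..N}. \<bar>pmf \<mu> x - pmf \<tau> x\<bar>) =
      (\<Sum>x\<in>{1..N}. 2 * (pmf \<mu> x * excess (pmf \<tau> x / pmf \<mu> x)) - (pmf \<mu> x - pmf \<tau> x))"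
  proof (rule sum.cong)
    fix x
    show "\<bar>pmf \<mu> x - pmf \<tau> x\<bar> = 2 * (pmf \<mu> x * excess (pmf \<tau> x / pmf \<mu> x)) - (pmf \<mu> x - pmf \<tau> x)"
    proof (cases "pmf \<mu> x = 0")
      case False
      then have "pmf \<mu> x > 0"
        by (simp add: order_less_le)
      then show ?thesis
        by (auto simp: excess_def max_def min_def field_simps)
    qed simp
  qed simp
  also have "\<dots> = 2 * (\<Sum>x\<in>{1..N}. pmf \<mu> x * excess (pmf \<tau> x / pmf \<mu> x))"
    using sum_pmf_eq_1[OF finite_atLeastAtMost assms(1)] sum_pmf_eq_1[OF finite_atLeastAtMost assms(2)]
    by (simp add: sum_subtractf sum_distrib_left)
  finally show ?thesis
    by (simp add: d_TV_def)
qed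

text \<open>The constant 46 is 12 for accurate estimates, 13 for the failure of each of the two
  density estimates, and 4 for the mass of the light elements of each distribution.\<close>

lemma tv_sample_alg_bias:
  fixes N :: nat and \<kappa> :: real
  assumes \<mu>: "set_pmf \<mu> \<subseteq> {1..N}" "cond_sampling_oracle {1..N} \<mu> M"
    and \<tau>: "set_pmf \<tau> \<subseteq> {1..N}" "cond_sampling_oracle {1..N} \<tau> T"
    and \<kappa>: "0 < \<kappa>" "\<kappa> \<le> 1 / 6" and L: "N \<le> 2 ^ L" "L \<le> 2 ^ k" and n: "real n \<ge> 1 / \<kappa> ^ 5"
  defines "P \<equiv> result M T (tv_sample_alg k L N n \<kappa>)"
  shows "finite (set_pmf P)" "set_pmf P \<subseteq> {0..1}"
    "\<bar>measure_pmf.expectation P (\<lambda>v. v) - d_TV {1..N} \<mu> \<tau>\<bar> \<le> 46 * \<kappa>"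
proof -
  let ?R = "\<lambda>x. result M T (excess_alg k L N n \<kappa> x)"
  have om: "cond_oracle N \<mu> M T True x" and ot: "cond_oracle N \<tau> M T False x" if "x \<in> {1..N}" for x
    using \<mu> \<tau> that by (auto simp: cond_oracle_def)
  obtain z where "z \<in> {1..N}"
    using \<mu>(1) set_pmf_not_empty[of \<mu>] by blast
  then have "M {1..N} = \<mu>"
    using cond_oracle.orc_UNIV[OF om] by simp
  then have P: "P = bind_pmf \<mu> ?R"
    by (simp add: P_def tv_sample_alg_def)
  have finR: "finite (set_pmf (?R x))" if "x \<in> {1..N}" for x
    using cond_oracle.finite_result_density_alg[OF om[OF that]]
      cond_oracle.finite_result_density_alg[OF ot[OF that]]
    by (simp add: excess_alg_def)
  have R01: "set_pmf (?R x) \<subseteq> {0..1}" for x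
    by (auto simp: excess_alg_def excess_bounds)
  have fin\<mu>: "finite (set_pmf \<mu>)"
    using \<mu>(1) by (rule finite_subset) simp
  show "finite (set_pmf P)"
    unfolding P using \<mu>(1) fin\<mu> finR by auto
  show "set_pmf P \<subseteq> {0..1}"
    unfolding P using R01 by auto
  define e where "e x = excess (pmf \<tau> x / pmf \<mu> x)" for x
  \<comment> \<open>Penalties for light elements. If \<open>x\<close> is light for
    \<open>\<mu>\<close>, the estimate may be arbitrary at cost 1, which averages to the
    \<open>\<mu>\<close>-mass of such elements. If \<open>\<tau> x\<close> was replaced by 0, the
    error is at most \<open>b x\<close>, and \<open>pmf \<mu> x * b x\<close> is at most
    \<open>pmf \<tau> x\<close>, so it averages to a \<open>\<tau>\<close>-mass.\<close>
  define a where "a x = (of_bool (win_prob N \<mu> x \<le> 2 * \<kappa>) :: real)" for x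
  define b where "b x = of_bool (win_prob N \<tau> x \<le> 2 * \<kappa>) * min 1 (pmf \<tau> x / pmf \<mu> x)" for x
  have b0: "b x \<ge> 0" for x
    by (simp add: b_def)
  have R: "\<bar>measure_pmf.expectation (?R x) (\<lambda>v. v) - e x\<bar> \<le> (12 * \<kappa> + a x + b x) + (13 * \<kappa> + (13 * \<kappa> + 0))"
    if x: "x \<in> {1..N}" "pmf \<mu> x > 0" for x
  proof (rule expectation_close[OF finR[OF x(1)] R01])
    show "measure_pmf.prob (?R x) {v. \<not> \<bar>v - e x\<bar> \<le> 12 * \<kappa> + a x + b x} \<le> 13 * \<kappa> + (13 * \<kappa> + 0)"
      unfolding excess_alg_def result_bind_alg
    proof (rule prob_bind_union_bound[OF cond_oracle.density_alg_fail[OF om[OF x(1)] \<kappa> L n]],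
        use \<kappa> in simp,
        rule prob_bind_union_bound[OF cond_oracle.density_alg_fail[OF ot[OF x(1)] \<kappa> L n]], simp)
      fix u t
      assume u: "(u = 0 \<and> win_prob N \<mu> x \<le> 2 * \<kappa>) \<or> \<bar>pmf \<mu> x - u\<bar> \<le> 3 * \<kappa> * u"
        and t: "(t = 0 \<and> win_prob N \<tau> x \<le> 2 * \<kappa>) \<or> \<bar>pmf \<tau> x - t\<bar> \<le> 3 * \<kappa> * t"
      have "\<bar>excess (t / u) - e x\<bar> \<le> 12 * \<kappa> + a x + b x"
      proof (cases "win_prob N \<mu> x \<le> 2 * \<kappa>")
        case True
        have "\<bar>excess (t / u) - e x\<bar> \<le> 1"
          using excess_bounds[of "t / u"] excess_bounds[of "pmf \<tau> x / pmf \<mu> x"] by (auto simp: e_def)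
        then show ?thesis
          using True \<kappa> b0[of x] by (simp add: a_def)
      next
        case False
        then have u': "\<bar>pmf \<mu> x - u\<bar> \<le> 3 * \<kappa> * u"
          using u by simp
        show ?thesis
          using t
        proof (elim disjE)
          assume t': "t = 0 \<and> win_prob N \<tau> x \<le> 2 * \<kappa>"
          have "pmf \<tau> x / pmf \<mu> x \<ge> 0"
            by simp
          then have "\<bar>excess (t / u) - e x\<bar> \<le> b x"
            using t' by (auto simp: b_def e_def excess_def max_def min_def)
          then show ?thesis
            using \<kappa> False by (simp add: a_def)
        next
          assume "\<bar>pmf \<tau> x - t\<bar> \<le> 3 * \<kappa> * t"
          then have "\<bar>excess (t / u) - e x\<bar> \<le> 12 * \<kappa>"
            unfolding e_def using \<kappa> x u' by (intro excess_ratio_error) auto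
          then show ?thesis
            using b0[of x] by (simp add: a_def)
        qed
      qed
      then show "measure_pmf.prob (result M T (Output (excess (t / u))))
          {v. \<not> \<bar>v - e x\<bar> \<le> 12 * \<kappa> + a x + b x} \<le> 0"
        by (simp add: measure_return_pmf)
    qed
  qed (use \<kappa> b0[of x] in \<open>auto simp: e_def a_def excess_bounds\<close>)
  have "measure_pmf.expectation P (\<lambda>v. v) =
      (\<Sum>x\<in>{1..N}. pmf \<mu> x *\<^sub>R measure_pmf.expectation (?R x) (\<lambda>v. v))"
    unfolding P using \<mu>(1) finR by (intro pmf_expectation_bind) auto
  then have "measure_pmf.expectation P (\<lambda>v. v) - d_TV {1..N} \<mu> \<tau> =
      (\<Sum>x\<in>{1..N}. pmf \<mu> x * (measure_pmf.expectation (?R x) (\<lambda>v. v) - e x))"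
    unfolding d_TV_eq_sum_excess[OF \<mu>(1) \<tau>(1)] e_def
    by (simp only: real_scaleR_def sum_subtractf right_diff_distrib)
  then have "\<bar>measure_pmf.expectation P (\<lambda>v. v) - d_TV {1..N} \<mu> \<tau>\<bar> \<le>
      (\<Sum>x\<in>{1..N}. \<bar>pmf \<mu> x * (measure_pmf.expectation (?R x) (\<lambda>v. v) - e x)\<bar>)"
    by (simp only: sum_abs)
  also have "\<dots> \<le> (\<Sum>x\<in>{1..N}. pmf \<mu> x * (38 * \<kappa>) + of_bool (win_prob N \<mu> x \<le> 2 * \<kappa>) * pmf \<mu> x +
      of_bool (win_prob N \<tau> x \<le> 2 * \<kappa>) * pmf \<tau> x)"
  proof (rule sum_mono)
    fix x assume x: "x \<in> {1..N}"
    show "\<bar>pmf \<mu> x * (measure_pmf.expectation (?R x) (\<lambda>v. v) - e x)\<bar> \<le>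
        pmf \<mu> x * (38 * \<kappa>) + of_bool (win_prob N \<mu> x \<le> 2 * \<kappa>) * pmf \<mu> x +
        of_bool (win_prob N \<tau> x \<le> 2 * \<kappa>) * pmf \<tau> x"
    proof (cases "pmf \<mu> x = 0")
      case False
      then have pos: "pmf \<mu> x > 0"
        by (simp add: order_less_le)
      have "\<bar>pmf \<mu> x * (measure_pmf.expectation (?R x) (\<lambda>v. v) - e x)\<bar> \<le> pmf \<mu> x * (38 * \<kappa> + a x + b x)"
        unfolding abs_mult using R[OF x pos] pos by (intro mult_mono) auto
      moreover have "pmf \<mu> x * b x \<le> of_bool (win_prob N \<tau> x \<le> 2 * \<kappa>) * pmf \<tau> x"
        using pos by (auto simp: b_def min_def field_simps)
      ultimately show ?thesis
        by (simp add: a_def algebra_simps)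
    qed simp
  qed
  also have "\<dots> = 38 * \<kappa> + (\<Sum>x\<in>{x\<in>{1..N}. win_prob N \<mu> x \<le> 2 * \<kappa>}. pmf \<mu> x) +
      (\<Sum>x\<in>{x\<in>{1..N}. win_prob N \<tau> x \<le> 2 * \<kappa>}. pmf \<tau> x)"
  proof -
    have "(\<Sum>x\<in>{1..N}. of_bool (Q x) * f x) = (\<Sum>x\<in>{x\<in>{1..N}. Q x}. f x)" for Q and f :: "nat \<Rightarrow> real"
      by (subst sum.inter_filter) (simp, intro sum.cong refl, simp)
    then show ?thesis
      using sum_pmf_eq_1[OF finite_atLeastAtMost \<mu>(1)] by (simp add: sum.distrib sum_distrib_right[symmetric])
  qed
  also have "\<dots> \<le> 38 * \<kappa> + 2 * (2 * \<kappa>) + 2 * (2 * \<kappa>)"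
    using \<kappa> by (intro add_mono order.refl sum_pmf_small_win_prob_le) auto
  finally show "\<bar>measure_pmf.expectation P (\<lambda>v. v) - d_TV {1..N} \<mu> \<tau>\<bar> \<le> 46 * \<kappa>"
    by simp
qed

section \<open>Choice of parameters, correctness and sample count\<close>

text \<open>With \<open>\<kappa> = \<epsilon> / 100\<close> the bias is at most
  \<open>46 * \<epsilon> / 100\<close>, below \<open>\<epsilon> / 2\<close>. The variance is at most
  1/4, so \<open>3 / \<epsilon>\<^sup>2\<close> runs deviate by more than
  \<open>\<epsilon> / 2\<close> with probability at most 1/3. For \<open>\<epsilon> \<ge> 1\<close>
  the answer 0 is accurate enough, as the distance lies in the unit interval.\<close>

definition tv_alg :: "nat \<Rightarrow> real \<Rightarrow> nat cond_alg" where
  "tv_alg N \<epsilon> =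
     (if \<epsilon> \<ge> 1 then Output 0
      else let m = nat \<lceil>3 / \<epsilon>\<^sup>2\<rceil>; n = nat \<lceil>1 / (\<epsilon> / 100) ^ 5\<rceil>;
               L = nat \<lceil>log 2 N\<rceil>; k = nat \<lceil>log 2 (log 2 N)\<rceil>
           in bind_alg (repeat_sum m (tv_sample_alg k L N n (\<epsilon> / 100))) (\<lambda>s. Output (s / m)))"

lemma tv_alg_correct:
  fixes N :: nat and \<epsilon> :: real
  assumes N: "N \<ge> 1" and \<epsilon>: "\<epsilon> > 0"
    and \<mu>: "set_pmf \<mu> \<subseteq> {1..N}" "cond_sampling_oracle {1..N} \<mu> M"
    and \<tau>: "set_pmf \<tau> \<subseteq> {1..N}" "cond_sampling_oracle {1..N} \<tau> T"
  shows "measure_pmf.prob (result M T (tv_alg N \<epsilon>))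
    {v. v \<in> {d_TV {1..N} \<mu> \<tau> - \<epsilon> .. d_TV {1..N} \<mu> \<tau> + \<epsilon>}} \<ge> 2 / 3"
proof (cases "\<epsilon> \<ge> 1")
  case True
  have "d_TV {1..N} \<mu> \<tau> \<le> (\<Sum>x\<in>{1..N}. pmf \<mu> x * 1)"
    unfolding d_TV_eq_sum_excess[OF \<mu>(1) \<tau>(1)] by (intro sum_mono mult_left_mono excess_bounds) auto
  also have "\<dots> = 1"
    using sum_pmf_eq_1[OF finite_atLeastAtMost \<mu>(1)] by simp
  finally have "d_TV {1..N} \<mu> \<tau> \<le> 1" .
  moreover have "d_TV {1..N} \<mu> \<tau> \<ge> 0"
    by (auto simp: d_TV_def intro!: sum_nonneg)
  ultimately show ?thesis
    using True \<epsilon> by (simp add: tv_alg_def measure_return_pmf indicator_def)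
next
  case False
  define m where "m = nat \<lceil>3 / \<epsilon>\<^sup>2\<rceil>"
  define n where "n = nat \<lceil>1 / (\<epsilon> / 100) ^ 5\<rceil>"
  define L where "L = nat \<lceil>log 2 N\<rceil>"
  define k where "k = nat \<lceil>log 2 (log 2 N)\<rceil>"
  define a where "a = tv_sample_alg k L N n (\<epsilon> / 100)"
  define E where "E = measure_pmf.expectation (result M T a) (\<lambda>v. v)"
  have "real N = 2 powr (log 2 N)"
    using N by simp
  also have "\<dots> \<le> 2 powr (real L)"
    by (intro powr_mono) (auto simp: L_def real_nat_ceiling_ge)
  finally have NL: "N \<le> 2 ^ L"
    by (simp add: powr_realpow)
  \<comment> \<open>As \<open>2 ^ k\<close> is an integer, the bound
    \<open>log 2 N \<le> 2 ^ k\<close> passes to the ceiling \<open>L\<close>. For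
    \<open>N = 1\<close> the iterated logarithm says nothing, but \<open>L = 0\<close>.\<close>
  have Lk: "L \<le> 2 ^ k"
  proof (cases "N = 1")
    case False
    then have "log 2 N \<ge> 1"
      using N by (simp add: le_log_iff)
    then have "log 2 N = 2 powr (log 2 (log 2 N))"
      by simp
    also have "\<dots> \<le> 2 powr (real k)"
      by (intro powr_mono) (auto simp: k_def real_nat_ceiling_ge)
    also have "\<dots> = real (2 ^ k)"
      by (simp add: powr_realpow)
    finally show ?thesis
      by (simp add: L_def ceiling_le_iff nat_le_iff)
  qed (simp add: L_def)
  have n: "real n \<ge> 1 / (\<epsilon> / 100) ^ 5"
    unfolding n_def by (rule real_nat_ceiling_ge)
  have m: "real m \<ge> 3 / \<epsilon>\<^sup>2"
    unfolding m_def by (rule real_nat_ceiling_ge)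
  moreover have "3 / \<epsilon>\<^sup>2 > 0"
    using \<epsilon> by simp
  ultimately have m0: "m > 0"
    by linarith
  note bias = tv_sample_alg_bias[OF \<mu> \<tau> _ _ NL Lk n, folded a_def]
  have fin: "finite (set_pmf (result M T a))" and set: "set_pmf (result M T a) \<subseteq> {0..1}"
    and E: "\<bar>E - d_TV {1..N} \<mu> \<tau>\<bar> \<le> 46 * (\<epsilon> / 100)"
    unfolding E_def using \<epsilon> False bias by auto
  have V: "measure_pmf.expectation (result M T a) (\<lambda>r. (r - E)\<^sup>2) \<le> 1 / 4"
  proof -
    have "measure_pmf.expectation (result M T a) (\<lambda>r. (r - E)\<^sup>2) \<le> E * (1 - E)"
      unfolding E_def by (intro variance_unit_interval_le fin set)
    also have "\<dots> = 1 / 4 - (E - 1 / 2)\<^sup>2"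
      by (simp add: power2_eq_square algebra_simps)
    finally show ?thesis
      using zero_le_power2[of "E - 1 / 2"] by linarith
  qed
  have "measure_pmf.prob (result M T (repeat_sum m a)) {s. \<not> \<bar>s / m - E\<bar> \<le> \<epsilon> / 2} \<le> 1 / 4 / (m * (\<epsilon> / 2)\<^sup>2)"
    using \<epsilon> by (intro repeat_sum_chebyshev[OF fin E_def V m0]) auto
  also have "\<dots> = 1 / (m * \<epsilon>\<^sup>2)"
    by (simp add: power2_eq_square)
  also have "\<dots> \<le> 1 / 3"
    using m \<epsilon> by (intro divide_left_mono) (auto simp: field_simps)
  finally have "measure_pmf.prob (result M T (repeat_sum m a)) {s. \<not> \<bar>s / m - E\<bar> \<le> \<epsilon> / 2} \<le> 1 / 3" .
  moreover have "measure_pmf.prob (result M T (repeat_sum m a)) {s. \<bar>s / m - E\<bar> \<le> \<epsilon> / 2} =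
      1 - measure_pmf.prob (result M T (repeat_sum m a)) {s. \<not> \<bar>s / m - E\<bar> \<le> \<epsilon> / 2}"
    by (subst measure_pmf.prob_compl[symmetric]) (auto intro!: arg_cong[where f = "measure_pmf.prob _"])
  moreover have "measure_pmf.prob (result M T (repeat_sum m a)) {s. \<bar>s / m - E\<bar> \<le> \<epsilon> / 2} \<le>
      measure_pmf.prob (result M T (repeat_sum m a))
        {s. s / m \<in> {d_TV {1..N} \<mu> \<tau> - \<epsilon> .. d_TV {1..N} \<mu> \<tau> + \<epsilon>}}"
  proof (intro measure_pmf.finite_measure_mono subsetI, unfold mem_Collect_eq atLeastAtMost_iff)
    fix s assume "\<bar>s / m - E\<bar> \<le> \<epsilon> / 2"
    then show "d_TV {1..N} \<mu> \<tau> - \<epsilon> \<le> s / m \<and> s / m \<le> d_TV {1..N} \<mu> \<tau> + \<epsilon>"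
      using E \<epsilon> by (intro conjI) linarith+
  qed simp
  moreover have "result M T (tv_alg N \<epsilon>) = map_pmf (\<lambda>s. s / m) (result M T (repeat_sum m a))"
    using False by (simp add: tv_alg_def a_def m_def n_def L_def k_def Let_def map_pmf_def)
  ultimately show ?thesis
    by (simp add: vimage_def)
qed

lemma log_log_nonneg: "N \<ge> 1 \<Longrightarrow> log 2 (log 2 (real N)) \<ge> 0"
proof (cases "N = 1")
  case False
  assume "N \<ge> 1"
  with False have "log 2 N \<ge> 1"
    by (simp add: le_log_iff)
  then show ?thesis
    by simp
qed (simp add: log_def)

lemma query_bound_tv_alg:
  fixes N :: nat and \<epsilon> :: real
  assumes N: "N \<ge> 1" and \<epsilon>: "\<epsilon> > 0"
  obtains q where "query_bound (tv_alg N \<epsilon>) q" "real q \<le> 240000000052 * main_bound N \<epsilon>"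
proof (cases "\<epsilon> \<ge> 1")
  case True
  have "main_bound N \<epsilon> \<ge> 0"
    using log_log_nonneg[OF N] \<epsilon> by (simp add: main_bound_def)
  then show ?thesis
    using True by (intro that[of 0]) (auto simp: tv_alg_def)
next
  case False
  define m where "m = nat \<lceil>3 / \<epsilon>\<^sup>2\<rceil>"
  define n where "n = nat \<lceil>1 / (\<epsilon> / 100) ^ 5\<rceil>"
  define k where "k = nat \<lceil>log 2 (log 2 N)\<rceil>"
  define l where "l = log 2 (log 2 (real N))"
  have l: "l \<ge> 0"
    unfolding l_def using N by (rule log_log_nonneg)
  have k: "real k \<le> l + 1"
    using l of_int_ceiling_le_add_one[of l] by (simp add: k_def l_def)
  have n: "real n \<le> 10 ^ 10 / \<epsilon> ^ 5 + 1"
    using of_int_ceiling_le_add_one[of "1 / (\<epsilon> / 100) ^ 5"] \<epsilon> by (simp add: n_def power_divide)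
  have m: "real m \<le> 3 / \<epsilon>\<^sup>2 + 1"
    using of_int_ceiling_le_add_one[of "3 / \<epsilon>\<^sup>2"] \<epsilon> by (simp add: m_def)
  have e1: "1 \<le> 1 / \<epsilon> ^ j" for j
    using False \<epsilon> by (simp add: power_le_one)
  have m4: "real m \<le> 4 / \<epsilon>\<^sup>2"
    using m e1[of 2] by simp
  \<comment> \<open>Rounding up contributes \<open>1 + 6 + 6 = 13\<close>, absorbed by
    \<open>1 \<le> 1 / \<epsilon> ^ 5\<close>. Multiplied by the 4 from \<open>m4\<close>, this
    gives the constant 240000000052.\<close>
  have s: "real (1 + 6 * k + 6 * n) \<le> 6 * l + 60000000013 * (1 / \<epsilon> ^ 5)"
    using k n e1[of 5] by simp
  have "query_bound (bind_alg (repeat_sum m (tv_sample_alg k L N n (\<epsilon> / 100))) (\<lambda>s. Output (s / m)))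
      (m * (1 + 6 * k + 6 * n) + 0)" for L
    by (intro query_bound_bind_alg query_bound_repeat_sum query_bound_tv_sample_alg) simp
  then have "query_bound (tv_alg N \<epsilon>) (m * (1 + 6 * k + 6 * n) + 0)"
    unfolding tv_alg_def Let_def m_def n_def k_def using False by (simp only: if_False)
  moreover have "real (m * (1 + 6 * k + 6 * n) + 0) \<le> 240000000052 * main_bound N \<epsilon>"
  proof -
    have "real (m * (1 + 6 * k + 6 * n) + 0) = real m * real (1 + 6 * k + 6 * n)"
      unfolding add_0_right by (rule of_nat_mult)
    also have "\<dots> \<le> 4 / \<epsilon>\<^sup>2 * (6 * l + 60000000013 * (1 / \<epsilon> ^ 5))"
      using m4 s by (intro mult_mono) auto
    also have "\<dots> = 24 * (l / \<epsilon>\<^sup>2) + 240000000052 * (1 / \<epsilon> ^ 7)"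
      using \<epsilon> by (simp add: field_simps eval_nat_numeral)
    also have "\<dots> \<le> 240000000052 * (l / \<epsilon>\<^sup>2) + 240000000052 * (1 / \<epsilon> ^ 7)"
      using l \<epsilon> by (intro add_right_mono mult_right_mono) auto
    finally show ?thesis
      by (simp add: main_bound_def l_def algebra_simps)
  qed
  ultimately show ?thesis
    by (rule that)
qed

theorem theorem1p4:
  "\<exists>(alg :: nat \<Rightarrow> real \<Rightarrow> nat cond_alg) (C :: real) (p :: real poly).
     \<forall>(N :: nat) (\<epsilon> :: real) (\<mu> :: nat pmf) (\<tau> :: nat pmf) orc_\<mu> orc_\<tau>.
       N \<ge> 1 \<and> \<epsilon> > 0 \<and> set_pmf \<mu> \<subseteq> {1..N} \<and> set_pmf \<tau> \<subseteq> {1..N} \<and>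
       cond_sampling_oracle {1..N} \<mu> orc_\<mu> \<and> cond_sampling_oracle {1..N} \<tau> orc_\<tau> \<longrightarrow>
         measure_pmf.prob (run orc_\<mu> orc_\<tau> (alg N \<epsilon>))
           {(v, q). v \<in> {d_TV {1..N} \<mu> \<tau> - \<epsilon> .. d_TV {1..N} \<mu> \<tau> + \<epsilon>}} \<ge> 2 / 3 \<and>
         (\<forall>(v, q) \<in> set_pmf (run orc_\<mu> orc_\<tau> (alg N \<epsilon>)).
            real q \<le> C * (main_bound N \<epsilon> * poly p (log 2 (1 / \<epsilon>))))"
proof (intro exI[of _ tv_alg] exI[of _ "240000000052 :: real"] exI[of _ "[:1:]"] allI impI conjI)
  fix N :: nat and \<epsilon> :: real and \<mu> \<tau> :: "nat pmf" and M T
  assume A: "N \<ge> 1 \<and> \<epsilon> > 0 \<and> set_pmf \<mu> \<subseteq> {1..N} \<and> set_pmf \<tau> \<subseteq> {1..N} \<and>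
    cond_sampling_oracle {1..N} \<mu> M \<and> cond_sampling_oracle {1..N} \<tau> T"
  have "measure_pmf.prob (run M T (tv_alg N \<epsilon>))
      {(v, q). v \<in> {d_TV {1..N} \<mu> \<tau> - \<epsilon> .. d_TV {1..N} \<mu> \<tau> + \<epsilon>}} =
      measure_pmf.prob (result M T (tv_alg N \<epsilon>))
      {v. v \<in> {d_TV {1..N} \<mu> \<tau> - \<epsilon> .. d_TV {1..N} \<mu> \<tau> + \<epsilon>}}"
    unfolding result_def measure_map_pmf by (rule arg_cong[where f = "measure_pmf.prob _"]) auto
  then show "measure_pmf.prob (run M T (tv_alg N \<epsilon>))
      {(v, q). v \<in> {d_TV {1..N} \<mu> \<tau> - \<epsilon> .. d_TV {1..N} \<mu> \<tau> + \<epsilon>}} \<ge> 2 / 3"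
    using tv_alg_correct[of N \<epsilon> \<mu> M \<tau> T] A by simp
  \<comment> \<open>No logarithmic factor is lost, so the constant polynomial \<open>[:1:]\<close>
    serves; it also stays positive when \<open>\<epsilon> > 1\<close> makes the logarithm
    negative.\<close>
  obtain q' where "query_bound (tv_alg N \<epsilon>) q'" "real q' \<le> 240000000052 * main_bound N \<epsilon>"
    using A query_bound_tv_alg by blast
  then show "\<forall>(v, q)\<in>set_pmf (run M T (tv_alg N \<epsilon>)).
      real q \<le> 240000000052 * (main_bound N \<epsilon> * poly [:1:] (log 2 (1 / \<epsilon>)))"
    by (fastforce dest: query_bound_run)
qed

end
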